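(* Let $t_0$ be a fixed interior point of $J$ and let $x_n=x_{b,n}+v_n$, $p$, $d_n$, $\tilde v_n(\cdot;t_0)$, $g_n$, $y_n$ be as in the context. Suppose that: (A1) there is a stochastic process $\tilde v(\cdot;t_0)\neq 0$ such that $\tilde v_n(\cdot;t_0)\xrightarrow{\mathcal L}\tilde v(\cdot;t_0)$ on $D(-\infty,\infty)$ as $n\to\infty$; (A2) the functions $x_{b,n}$, $n\ge1$, are convex, and there is a constant $A>0$ such that for each $c>0$, $\sup_{|s|\le c}|g_n(s)-A|s|^p|\to0$ as $n\to\infty$; (A3) for every $\delta>0$ there are finite $\tau=\tau(\delta)>0$ and $\kappa=\kappa(\delta)>0$ such that $\liminf_{n\to\infty}P\left(\inf_{|s|\ge\tau}(y_n(s)-\kappa|s|)>0\right)>1-\delta$; (A4) given $\varepsilon,\delta,\tilde\tau>0$, for all large enough $c>0$, $$\limsup_{n\to\infty}P\left(\inf_{\tilde\tau\le s\le c}\frac{y_n(s)}{s}-\inf_{\tilde\tau\le s}\frac{y_n(s)}{s}>\varepsilon\right)<\delta,\qquad \limsup_{n\to\infty}P\left(\sup_{-c\le s\le-\tilde\tau}\frac{y_n(s)}{s}-\sup_{s\le-\tilde\tau}\frac{y_n(s)}{s}<-\varepsilon\right)<\delta;$$ (A5) for each $\varepsilon,\delta>0$ there is $\tau=\tau(\varepsilon,\delta)>0$ such that $P\left(\sup_{|s|\ge\tau}\left|\frac{\tilde v(s;t_0)}{A|s|^p}\right|>\varepsilon\right)\le\delta$; (A6) with $y(s)=A|s|^p+\tilde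 v(s;t_0)$, for each $c>0$, $T_c(y_n)'(0)\xrightarrow{\mathcal L}T_c(y)'(0)$ as $n\to\infty$. Then, as $n\to\infty$, $$d_n^{-p+1}\,[T_J(x_n)'(t_0)-x_{b,n}'(t_0)]\xrightarrow{\mathcal L}T\left(A|s|^p+\tilde v(s;t_0)\right)'(0).$$ Further, if $a\in\mathbb R$ is such that $P\left(T(A|s|^p+\tilde v(s;t_0))'(0)=a\right)=0$, then $$\lim_{n\to\infty}P\left\{d_n^{-p+1}[T_J(x_n)'(t_0)-x_{b,n}'(t_0)]<a\right\}=P\left\{\arg\min_{s\in\mathbb R}\left(A|s|^p+\tilde v(s;t_0)-as\right)>0\right\},$$ with $A$ the constant in (A2).
   Context: $J\subset\mathbb R$ is a finite or infinite interval; $D(J)$ is the space of functions $J\to\mathbb R$ that are right continuous with left-hand limits. For an interval $O$ and a function $x$ on $O$, $T_O(x)=\sup\{z: z:O\to\mathbb R \text{ convex}, z\le x\}$ (pointwise supremum) is the greatest convex minorant of $x$ on $O$, and $T_O(x)'$ denotes its right-hand derivative; $T=T_{\mathbb R}$, $T_c=T_{[-c,c]}$. For any process $x$, $\arg\min_{s\in\mathbb R}(x(s))$ means the infimum of all points at which the minimum is attained. $\{x_n\}_{n\ge1}$ is a sequence of stochastic processes in $D(J)$, a.s. bounded from below on $J$, with $x_n(t)=x_{b,n}(t)+v_n(t)$, $t\in J$, where $x_{b,n}$ is deterministic and $v_n\in D(J)$ is a stochastic process. $1<p<\infty$ is a fixed constant and $d_n\downarrow0$ a fixed sequence. Put $J_{n,t_0}=d_n^{-1}(J-t_0)$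 and, for $s\in J_{n,t_0}$, $$\tilde v_n(s;t_0)=d_n^{-p}(v_n(t_0+sd_n)-v_n(t_0)),$$ $$g_n(s)=d_n^{-p}\left(x_{b,n}(t_0+sd_n)-x_{b,n}(t_0)-x_{b,n}'(t_0)sd_n\right),\qquad y_n(s)=g_n(s)+\tilde v_n(s;t_0).$$ When regarded as an element of $D(-\infty,\infty)$, $\tilde v_n(\cdot;t_0)$ is extended from $J_{n,t_0}$ to $\mathbb R$ by constants beyond the endpoints of $J_{n,t_0}$. Infima and suprema of expressions involving $y_n$ are over $s$ in the domain $J_{n,t_0}$ of $y_n$. $D(-\infty,\infty)=D(\mathbb R)$ carries the metric $\rho(x,y)=\sum_{k\ge1}2^{-k}\rho_k(x,y)/(1+\rho_k(x,y))$, $\rho_k(x,y)=\sup_{s\in[-k,k]}|x(s)-y(s)|$ (uniform convergence on compacta), and the $\sigma$-algebra generated by the open balls; $\xrightarrow{\mathcal L}$ denotes weak convergence (convergence in distribution).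
   Formalization: In the second claim it is additionally assumed that, for the given a, the minimum over s of A|s|^p + ṽ(s;t_0) − as is almost surely attained; otherwise the arg min is undefined for right-continuous paths and the claim can fail. *)

theory Defs
  imports "HOL-Probability.Probability"
begin

abbreviation right_deriv :: "(real \<Rightarrow> real) \<Rightarrow> real \<Rightarrow> real" where
  "right_deriv f t \<equiv> vector_derivative f (at_right t)"

text \<open>The greatest convex minorant of \<open>x\<close> on the interval \<open>I\<close>. Only values at points of \<open>I\<close> are
  meaningful, and only if \<open>x\<close> has some convex minorant on \<open>I\<close>.\<close>

definition gcm :: "real set \<Rightarrow> (real \<Rightarrow> real) \<Rightarrow> real \<Rightarrow> real" where
  "gcm I x t = Sup {z t |z. convex_on I z \<and> (\<forall>s\<in>I. z s \<le> x s)}"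

text \<open>The infimum of all points at which the minimum over the real line is attained. It is
  meaningful only if the minimum is attained at all, which right continuity with left-hand limits
  does not guarantee. For such functions, events about it may be measurable only with respect to the
  completion of the probability measure.\<close>

definition left_arg_min :: "(real \<Rightarrow> real) \<Rightarrow> real" where
  "left_arg_min f = Inf {s. is_arg_min f (\<lambda>_. True) s}"

definition cadlag_on :: "real set \<Rightarrow> (real \<Rightarrow> real) set" where
  "cadlag_on J = {x. \<forall>t\<in>J. (x \<longlongrightarrow> x t) (at t within J \<inter> {t<..}) \<and>
                           (\<exists>l. (x \<longlongrightarrow> l) (at t within J \<inter> {..<t}))}"

text \<open>Extension of a function on the interval \<open>I\<close> by constants beyond the endpoints. An endpoint
  that does not belong to \<open>I\<close> contributes the one-sided limit there.\<close>

definition const_extension :: "real set \<Rightarrow> (real \<Rightarrow> real) \<Rightarrow> real \<Rightarrow> real" where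
  "const_extension I x s =
     (if s \<in> I then x s
      else if \<forall>r\<in>I. r < s then (if Sup I \<in> I then x (Sup I) else Lim (at_left (Sup I)) x)
      else (if Inf I \<in> I then x (Inf I) else Lim (at_right (Inf I)) x))"

definition DR :: "(real \<Rightarrow> real) set" where
  "DR = cadlag_on UNIV"

definition sup_dist :: "nat \<Rightarrow> (real \<Rightarrow> real) \<Rightarrow> (real \<Rightarrow> real) \<Rightarrow> real" where
  "sup_dist k x y = (SUP s\<in>{- real k..real k}. \<bar>x s - y s\<bar>)"

text \<open>Uniform convergence on compacta. The value 0 outside \<open>DR\<close> only serves the convention of
  \<^locale>\<open>Metric_space\<close> that distances are nonnegative everywhere.\<close>

definition DR_dist :: "(real \<Rightarrow> real) \<Rightarrow> (real \<Rightarrow> real) \<Rightarrow> real" where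
  "DR_dist x y =
     (if x \<in> DR \<and> y \<in> DR
      then \<Sum>k. (1/2) ^ Suc k * (sup_dist (Suc k) x y / (1 + sup_dist (Suc k) x y))
      else 0)"

lemma DR_locally_bounded:
  assumes "x \<in> DR"
  shows "\<exists>U B. open U \<and> t \<in> U \<and> (\<forall>s\<in>U. \<bar>x s\<bar> \<le> B)"
proof -
  from assms obtain l where r: "(x \<longlongrightarrow> x t) (at_right t)" and l: "(x \<longlongrightarrow> l) (at_left t)"
    unfolding DR_def cadlag_on_def by auto
  have "\<forall>\<^sub>F s in at_right t. dist (x s) (x t) < 1" using r by (rule tendstoD) simp
  then have R: "\<forall>\<^sub>F s in at_right t. \<bar>x s\<bar> \<le> max (\<bar>x t\<bar> + 1) (\<bar>l\<bar> + 1)"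
    by eventually_elim (auto simp: dist_real_def)
  have "\<forall>\<^sub>F s in at_left t. dist (x s) l < 1" using l by (rule tendstoD) simp
  then have L: "\<forall>\<^sub>F s in at_left t. \<bar>x s\<bar> \<le> max (\<bar>x t\<bar> + 1) (\<bar>l\<bar> + 1)"
    by eventually_elim (auto simp: dist_real_def)
  have "\<forall>\<^sub>F s in at t. \<bar>x s\<bar> \<le> max (\<bar>x t\<bar> + 1) (\<bar>l\<bar> + 1)"
    using L R by (simp add: eventually_at_split)
  then obtain U where U: "open U" "t \<in> U"
      "\<And>s. s \<in> U \<Longrightarrow> s \<noteq> t \<Longrightarrow> \<bar>x s\<bar> \<le> max (\<bar>x t\<bar> + 1) (\<bar>l\<bar> + 1)"
    unfolding eventually_at_topological by auto
  have "\<bar>x s\<bar> \<le> max (\<bar>x t\<bar> + 1) (\<bar>l\<bar> + 1)" if "s \<in> U" for s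
    using U(3)[OF that] by (cases "s = t") auto
  with U show ?thesis by blast
qed

lemma DR_bounded_on_interval:
  assumes "x \<in> DR"
  shows "\<exists>B. \<forall>s\<in>{a..b}. \<bar>x s\<bar> \<le> B"
proof -
  obtain U B where UB: "\<And>t. open (U t) \<and> t \<in> U t \<and> (\<forall>s\<in>U t. \<bar>x s\<bar> \<le> B t)"
    using DR_locally_bounded[OF assms] by metis
  obtain T where T: "T \<subseteq> {a..b}" "finite T" "{a..b} \<subseteq> (\<Union>t\<in>T. U t)"
    using UB by (rule_tac compactE_image[of "{a..b}" "{a..b}" U]) (auto; blast)+
  have "\<bar>x s\<bar> \<le> (\<Sum>t\<in>T. \<bar>B t\<bar>)" if s: "s \<in> {a..b}" for s
  proof -
    from s T obtain t where t: "t \<in> T" "s \<in> U t" by blast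
    have "\<bar>x s\<bar> \<le> \<bar>B t\<bar>" using UB t by force
    also have "\<dots> \<le> (\<Sum>t\<in>T. \<bar>B t\<bar>)" using T(2) t(1) by (intro member_le_sum) auto
    finally show ?thesis .
  qed
  then show ?thesis by blast
qed

lemma sup_dist_bdd:
  assumes "x \<in> DR" "y \<in> DR"
  shows "bdd_above ((\<lambda>s. \<bar>x s - y s\<bar>) ` {- real k..real k})"
proof -
  obtain B C where "\<forall>s\<in>{- real k..real k}. \<bar>x s\<bar> \<le> B" "\<forall>s\<in>{- real k..real k}. \<bar>y s\<bar> \<le> C"
    using assms DR_bounded_on_interval by meson
  then have "\<bar>x s - y s\<bar> \<le> B + C" if "s \<in> {- real k..real k}" for s
    using that by (smt (verit))
  then show ?thesis by (intro bdd_aboveI2)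
qed

lemma sup_dist_upper:
  assumes "x \<in> DR" "y \<in> DR" "s \<in> {- real k..real k}"
  shows "\<bar>x s - y s\<bar> \<le> sup_dist k x y"
  unfolding sup_dist_def using sup_dist_bdd[OF assms(1,2)] assms(3) by (rule cSUP_upper2) simp

lemma sup_dist_nonneg:
  assumes "x \<in> DR" "y \<in> DR"
  shows "0 \<le> sup_dist k x y"
  using sup_dist_upper[OF assms, of 0 k] by simp

lemma sup_dist_triangle:
  assumes "x \<in> DR" "y \<in> DR" "z \<in> DR"
  shows "sup_dist k x z \<le> sup_dist k x y + sup_dist k y z"
  unfolding sup_dist_def[of k x z]
proof (rule cSUP_least)
  fix s assume s: "s \<in> {- real k..real k}"
  show "\<bar>x s - z s\<bar> \<le> sup_dist k x y + sup_dist k y z"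
    using sup_dist_upper[OF assms(1,2) s] sup_dist_upper[OF assms(2,3) s] by linarith
qed simp

lemma DR_dist_summable:
  assumes "x \<in> DR" "y \<in> DR"
  shows "summable (\<lambda>k. (1/2) ^ Suc k * (sup_dist (Suc k) x y / (1 + sup_dist (Suc k) x y)))"
proof (rule summable_comparison_test')
  show "summable (\<lambda>k. (1/2::real) ^ Suc k)"
    by (intro summable_Suc_iff[THEN iffD2] summable_geometric) simp
  show "norm ((1/2) ^ Suc k * (sup_dist (Suc k) x y / (1 + sup_dist (Suc k) x y))) \<le> (1/2) ^ Suc k"
    if "0 \<le> k" for k
  proof -
    have "0 \<le> sup_dist (Suc k) x y / (1 + sup_dist (Suc k) x y)"
      "sup_dist (Suc k) x y / (1 + sup_dist (Suc k) x y) \<le> 1"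
      using sup_dist_nonneg[OF assms, of "Suc k"] by (auto simp: divide_simps)
    then have "\<bar>sup_dist (Suc k) x y / (1 + sup_dist (Suc k) x y)\<bar> \<le> 1" by linarith
    then show ?thesis
      unfolding real_norm_def abs_mult by (simp add: mult_left_le del: abs_divide)
  qed
qed

lemma frac_subadditive:
  fixes a b c :: real
  assumes "0 \<le> a" "0 \<le> b" "0 \<le> c" "c \<le> a + b"
  shows "c / (1 + c) \<le> a / (1 + a) + b / (1 + b)"
proof -
  have "c / (1 + c) \<le> (a + b) / (1 + (a + b))"
    using assms by (simp add: divide_simps) (simp add: algebra_simps)
  also have "\<dots> = a / (1 + (a + b)) + b / (1 + (a + b))" by (simp add: add_divide_distrib)
  also have "\<dots> \<le> a / (1 + a) + b / (1 + b)"
    using assms by (intro add_mono divide_left_mono) auto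
  finally show ?thesis .
qed

global_interpretation DR: Metric_space DR DR_dist
proof
  have sym: "sup_dist k x y = sup_dist k y x" for k x y
    by (simp add: sup_dist_def abs_minus_commute)
  show "DR_dist x y = DR_dist y x" for x y
    by (simp add: DR_dist_def sym[of _ x y])
  have nn: "0 \<le> (1/2) ^ Suc k * (sup_dist (Suc k) x y / (1 + sup_dist (Suc k) x y))"
    if "x \<in> DR" "y \<in> DR" for x y k
    using sup_dist_nonneg[OF that, of "Suc k"] by simp
  show "0 \<le> DR_dist x y" for x y
    using suminf_nonneg[OF DR_dist_summable nn] by (simp add: DR_dist_def)
  show "(DR_dist x y = 0) = (x = y)" if xy: "x \<in> DR" "y \<in> DR" for x y
  proof
    assume eq: "DR_dist x y = 0"
    show "x = y"
    proof
      fix s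
      have "\<forall>k. (1/2) ^ Suc k * (sup_dist (Suc k) x y / (1 + sup_dist (Suc k) x y)) = 0"
        using suminf_eq_zero_iff[OF DR_dist_summable[OF xy] nn[OF xy]] eq xy
        unfolding DR_dist_def by auto
      then have z: "sup_dist (Suc k) x y = 0" for k
        using sup_dist_nonneg[OF xy, of "Suc k"]
        by (auto simp del: power_Suc dest: spec[of _ k])
      obtain k where "\<bar>s\<bar> \<le> real k" using real_arch_simple by blast
      then have "s \<in> {- real (Suc k)..real (Suc k)}" by auto
      from sup_dist_upper[OF xy this] z[of k] show "x s = y s" by simp
    qed
  next
    assume "x = y"
    then show "DR_dist x y = 0" by (simp add: DR_dist_def sup_dist_def)
  qed
  show "DR_dist x z \<le> DR_dist x y + DR_dist y z" if "x \<in> DR" "y \<in> DR" "z \<in> DR" for x y z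
  proof -
    have "(1/2) ^ Suc k * (sup_dist (Suc k) x z / (1 + sup_dist (Suc k) x z)) \<le>
        (1/2) ^ Suc k * (sup_dist (Suc k) x y / (1 + sup_dist (Suc k) x y)) +
        (1/2) ^ Suc k * (sup_dist (Suc k) y z / (1 + sup_dist (Suc k) y z))" for k
      unfolding distrib_left[symmetric]
      using that by (intro mult_left_mono frac_subadditive sup_dist_nonneg sup_dist_triangle) auto
    then have "(\<Sum>k. (1/2) ^ Suc k * (sup_dist (Suc k) x z / (1 + sup_dist (Suc k) x z))) \<le>
        (\<Sum>k. (1/2) ^ Suc k * (sup_dist (Suc k) x y / (1 + sup_dist (Suc k) x y)) +
        (1/2) ^ Suc k * (sup_dist (Suc k) y z / (1 + sup_dist (Suc k) y z)))"
      using that by (intro suminf_le summable_add DR_dist_summable) auto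
    then show ?thesis
      using that suminf_add[OF DR_dist_summable DR_dist_summable, OF that(1,2,2,3)]
      by (simp add: DR_dist_def)
  qed
qed

definition DR_ball_algebra :: "(real \<Rightarrow> real) measure" where
  "DR_ball_algebra = sigma DR {DR.mball x r |x r. x \<in> DR}"

text \<open>The uniform metric is not separable, so its Borel sets exceed the \<open>\<sigma>\<close>-algebra generated by
  the open balls, and the continuous test functions have to be measurable with respect to the
  latter. The \<open>n\<close>-th element of the sequence may live on its own probability space.\<close>

definition conv_in_distr_DR ::
    "(nat \<Rightarrow> 'a measure) \<Rightarrow> (nat \<Rightarrow> 'a \<Rightarrow> real \<Rightarrow> real) \<Rightarrow> 'b measure \<Rightarrow> ('b \<Rightarrow> real \<Rightarrow> real) \<Rightarrow> bool" where
  "conv_in_distr_DR M X N Y \<longleftrightarrow>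
     (\<forall>n. X n \<in> M n \<rightarrow>\<^sub>M DR_ball_algebra) \<and> Y \<in> N \<rightarrow>\<^sub>M DR_ball_algebra \<and>
     (\<forall>f. continuous_map DR.mtopology euclideanreal f \<and> (\<exists>B. \<forall>x\<in>DR. \<bar>f x\<bar> \<le> B) \<and>
          f \<in> borel_measurable DR_ball_algebra \<longrightarrow>
          (\<lambda>n. integral\<^sup>L (M n) (\<lambda>\<omega>. f (X n \<omega>))) \<longlonglongrightarrow> integral\<^sup>L N (\<lambda>\<omega>. f (Y \<omega>)))"

definition conv_in_distr ::
    "(nat \<Rightarrow> 'a measure) \<Rightarrow> (nat \<Rightarrow> 'a \<Rightarrow> real) \<Rightarrow> 'b measure \<Rightarrow> ('b \<Rightarrow> real) \<Rightarrow> bool" where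
  "conv_in_distr M X N Y \<longleftrightarrow>
     (\<forall>n. X n \<in> borel_measurable (M n)) \<and> Y \<in> borel_measurable N \<and>
     weak_conv_m (\<lambda>n. distr (M n) borel (X n)) (distr N borel Y)"

definition local_dom :: "real set \<Rightarrow> real \<Rightarrow> real \<Rightarrow> real set" where
  "local_dom J t0 d = (\<lambda>t. (t - t0) / d) ` J"

definition local_noise :: "real \<Rightarrow> real \<Rightarrow> real \<Rightarrow> (real \<Rightarrow> real) \<Rightarrow> real \<Rightarrow> real" where
  "local_noise p d t0 v s = d powr (- p) * (v (t0 + s * d) - v t0)"

text \<open>The slope subtracted is the right-hand derivative, which exists for convex functions at interior
  points even where they have a kink.\<close>

definition local_drift :: "real \<Rightarrow> real \<Rightarrow> real \<Rightarrow> (real \<Rightarrow> real) \<Rightarrow> real \<Rightarrow> real" where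
  "local_drift p d t0 xb s = d powr (- p) * (xb (t0 + s * d) - xb t0 - right_deriv xb t0 * s * d)"

definition local_proc ::
    "real \<Rightarrow> real \<Rightarrow> real \<Rightarrow> (real \<Rightarrow> real) \<Rightarrow> (real \<Rightarrow> real) \<Rightarrow> real \<Rightarrow> real" where
  "local_proc p d t0 xb v s = local_drift p d t0 xb s + local_noise p d t0 v s"

definition limit_proc :: "real \<Rightarrow> real \<Rightarrow> (real \<Rightarrow> real) \<Rightarrow> real \<Rightarrow> real" where
  "limit_proc A p w s = A * \<bar>s\<bar> powr p + w s"

end

theory Submission
  imports Defs
begin

text \<open>Call \<open>(m, b)\<close> the top tangent of \<open>f\<close> at \<open>t\<close> if the line through \<open>(t, m)\<close> with slope \<open>b\<close> lies
  below \<open>f\<close>, with \<open>m\<close> largest possible and then \<open>b\<close> largest possible; it consists of the value and the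
  right-hand derivative of the greatest convex minorant. Shrinking the interval only admits more
  lines, so a top tangent on \<open>[- c, c]\<close> that happens to lie below \<open>f\<close> everywhere is a global one. By
  (A1), (A2) and (A5), with high probability \<open>y\<^sub>n\<close> lies on \<open>[- c, c]\<close> between \<open>3/4 A|s|\<^sup>p - D\<close> and
  \<open>5/4 A|s|\<^sup>p + D\<close> with \<open>D\<close> independent of \<open>c\<close>, which bounds the top tangent at \<open>0\<close>; by (A4) the
  growth of \<open>y\<^sub>n(s)/s\<close> persists outside \<open>[- c, c]\<close>. Hence localisation leaves the slope at \<open>0\<close>
  unchanged with high probability, uniformly in \<open>n\<close>, and (A6) gives the limit. The formula for the
  distribution function follows since a minimiser of \<open>y(s) - a s\<close> yields a line of slope \<open>a\<close> below
  \<open>y\<close>, to be compared with the top tangent.\<close>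

subsection \<open>Greatest convex minorants and top tangents\<close>

text \<open>The slope at a fixed point is not monotone in the interval: new low values on the right
  decrease it, new low values on the left can increase it. Maximising height and then slope makes
  the comparison of intervals exact, so local and global slopes coincide on an event of large
  probability, and a single \<open>c\<close> per error level suffices in (A6). The order of the
  constants matters: \<open>D\<close> is read off the limit noise before any window is chosen, it
  determines the required linear growth and the radius beyond which that growth holds, and only then
  does (A4) supply \<open>c\<close>. The other obstacle is measurability. Convergence in
  distribution includes measurability of all slopes, also for paths without a minorant, while (A1)
  speaks only of the sigma-algebra generated by the balls. Right continuity reduces uncountable
  infima to countable ones; evaluations and envelope bounds are recovered from distances. The event
  about the minimiser is handled only up to null sets.\<close>

definition top_tangent :: "real set \<Rightarrow> (real \<Rightarrow> real) \<Rightarrow> real \<Rightarrow> real \<Rightarrow> real \<Rightarrow> bool" where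
  "top_tangent I f t m b \<longleftrightarrow>
     (\<forall>s\<in>I. m + b * (s - t) \<le> f s) \<and>
     (\<forall>m' b'. (\<forall>s\<in>I. m' + b' * (s - t) \<le> f s) \<longrightarrow> m' \<le> m) \<and>
     (\<forall>b'. (\<forall>s\<in>I. m + b' * (s - t) \<le> f s) \<longrightarrow> b' \<le> b)"

lemma top_tangent_unique:
  assumes "top_tangent I f t m b" "top_tangent I f t m' b'"
  shows "m = m'" "b = b'"
proof -
  show m: "m = m'" using assms unfolding top_tangent_def by (meson order_antisym)
  show "b = b'" using assms unfolding top_tangent_def m by (meson order_antisym)
qed

text \<open>The difference quotients decrease as \<open>s\<close> approaches \<open>t\<close> from
  the right, so their limit is their infimum \<open>b\<close>; the same infimum is the slope of a
  supporting line at an interior point. Both claims come from this one number.\<close>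

lemma convex_on_right_deriv:
  fixes z :: "real \<Rightarrow> real"
  assumes z: "convex_on I z" and t: "t \<in> interior I"
  shows "(z has_vector_derivative right_deriv z t) (at_right t)"
    and "s \<in> I \<Longrightarrow> z t + right_deriv z t * (s - t) \<le> z s"
proof -
  define b where "b = Inf ((\<lambda>r. (z t - z r) / (t - r)) ` ({t<..} \<inter> I))"
  have supp: "z t + b * (s - t) \<le> z s" if "s \<in> I" for s
    using convex_le_Inf_differential[OF z t that] by (simp add: b_def)
  obtain e where e: "0 < e" "cball t e \<subseteq> I" using t by (meson mem_interior_cball)
  have eI: "t + e \<in> I" and tI: "t \<in> I" using e by (auto simp: cball_def dist_real_def)
  have "((\<lambda>s. (z s - z t) / (s - t)) \<longlongrightarrow> b) (at_right t)"
  proof (rule tendstoI)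
    fix eps :: real assume eps: "0 < eps"
    have "\<exists>y\<in>(\<lambda>r. (z t - z r) / (t - r)) ` ({t<..} \<inter> I). y < b + eps"
    proof (rule cInf_lessD)
      have "t + e \<in> {t<..} \<inter> I" using eI e(1) by simp
      then show "(\<lambda>r. (z t - z r) / (t - r)) ` ({t<..} \<inter> I) \<noteq> {}" by blast
    qed (use eps in \<open>simp add: b_def\<close>)
    then obtain r where r: "r \<in> I" "t < r" "(z t - z r) / (t - r) < b + eps" by auto
    have "dist ((z s - z t) / (s - t)) b < eps" if s: "t < s" "s < r" for s
    proof -
      have sI: "s \<in> I"
        using convex_on_imp_convex[OF z] s tI r(1)
        by (meson less_imp_le mem_is_interval_1_I is_interval_convex_1)
      have "(z t - z s) / (t - s) \<le> (z t - z r) / (t - r)"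
        using convex_on_slope_le(1)[OF z tI r(1) s] .
      then have "(z t - z s) / (t - s) < b + eps" using r(3) by linarith
      moreover have "(z t - z s) / (t - s) = (z s - z t) / (s - t)"
        by (metis minus_diff_eq minus_divide_divide)
      moreover have "b \<le> (z s - z t) / (s - t)"
        using supp[OF sI] s by (simp add: pos_le_divide_eq)
      ultimately show ?thesis by (simp add: dist_real_def)
    qed
    then show "\<forall>\<^sub>F s in at_right t. dist ((z s - z t) / (s - t)) b < eps"
      using r(2) unfolding eventually_at_right_field by blast
  qed
  then have "(z has_vector_derivative b) (at_right t)"
    unfolding has_real_derivative_iff_has_vector_derivative[symmetric] has_field_derivative_iff .
  moreover from this have "right_deriv z t = b"
    by (rule vector_derivative_within[rotated]) simp
  ultimately show "(z has_vector_derivative right_deriv z t) (at_right t)"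
    and "s \<in> I \<Longrightarrow> z t + right_deriv z t * (s - t) \<le> z s"
    using supp by auto
qed

lemma right_deriv_ge:
  assumes "(z has_vector_derivative b) (at_right t)" "t < r"
    and le: "\<And>s. t < s \<Longrightarrow> s < r \<Longrightarrow> z t + c * (s - t) \<le> z s"
  shows "c \<le> b"
proof (rule tendsto_lowerbound)
  show "((\<lambda>s. (z s - z t) / (s - t)) \<longlongrightarrow> b) (at_right t)"
    using assms(1)
    unfolding has_real_derivative_iff_has_vector_derivative[symmetric] has_field_derivative_iff .
  have "c \<le> (z s - z t) / (s - t)" if "t < s" "s < r" for s
    using le[OF that] that by (simp add: pos_le_divide_eq)
  then show "\<forall>\<^sub>F s in at_right t. c \<le> (z s - z t) / (s - t)"
    using assms(2) unfolding eventually_at_right_field by blast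
qed simp

lemma gcm_le:
  assumes "convex_on I z" "\<And>s. s \<in> I \<Longrightarrow> z s \<le> f s" "t \<in> I"
  shows "gcm I f t \<le> f t"
  unfolding gcm_def using assms by (intro cSup_least) auto

lemma gcm_ge:
  assumes "convex_on I z" "\<And>s. s \<in> I \<Longrightarrow> z s \<le> f s" "t \<in> I"
  shows "z t \<le> gcm I f t"
  unfolding gcm_def using assms by (intro cSup_upper bdd_aboveI[of _ "f t"]) auto

lemma convex_on_gcm:
  assumes z: "convex_on I z" "\<And>s. s \<in> I \<Longrightarrow> z s \<le> f s"
  shows "convex_on I (gcm I f)"
  unfolding convex_on_def
proof (intro conjI ballI allI impI)
  show I: "convex I" using z(1) by (rule convex_on_imp_convex)
  fix x y u v :: real assume xy: "x \<in> I" "y \<in> I" "0 \<le> u" "0 \<le> v" "u + v = 1"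
  show "gcm I f (u *\<^sub>R x + v *\<^sub>R y) \<le> u * gcm I f x + v * gcm I f y"
    unfolding gcm_def[of I f "u *\<^sub>R x + v *\<^sub>R y"]
  proof (rule cSup_least)
    show "{w (u *\<^sub>R x + v *\<^sub>R y) |w. convex_on I w \<and> (\<forall>s\<in>I. w s \<le> f s)} \<noteq> {}"
      using z by auto
    fix a assume "a \<in> {w (u *\<^sub>R x + v *\<^sub>R y) |w. convex_on I w \<and> (\<forall>s\<in>I. w s \<le> f s)}"
    then obtain w where w: "a = w (u *\<^sub>R x + v *\<^sub>R y)" "convex_on I w" "\<And>s. s \<in> I \<Longrightarrow> w s \<le> f s"
      by auto
    have "a \<le> u * w x + v * w y" using w(1,2) xy unfolding convex_on_def by blast
    also have "\<dots> \<le> u * gcm I f x + v * gcm I f y"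
      using xy w by (intro add_mono mult_left_mono gcm_ge) auto
    finally show "a \<le> u * gcm I f x + v * gcm I f y" .
  qed
qed

lemma convex_on_affine:
  fixes m b t :: real
  assumes "convex I"
  shows "convex_on I (\<lambda>s. m + b * (s - t))"
proof (rule convex_onI)
  fix u x y :: real
  show "m + b * ((1 - u) *\<^sub>R x + u *\<^sub>R y - t) \<le> (1 - u) * (m + b * (x - t)) + u * (m + b * (y - t))"
    by (simp add: algebra_simps)
qed fact

text \<open>The minorant is convex, so its right tangent lies below it and hence below
  \<open>f\<close>. Conversely an affine minorant is itself convex and thus lies below
  \<open>gcm I f\<close>; at \<open>t\<close> this bounds its height, and to the right of
  \<open>t\<close>, once the heights agree, its slope.\<close>

lemma gcm_top_tangent:
  assumes I: "is_interval I" "t \<in> interior I"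
    and minor: "\<And>s. s \<in> I \<Longrightarrow> m0 + b0 * (s - t) \<le> f s"
  shows "top_tangent I f t (gcm I f t) (right_deriv (gcm I f) t)"
proof -
  have cI: "convex I" using I(1) by (simp add: is_interval_convex_1)
  have aff: "convex_on I (\<lambda>s. m + b * (s - t))" for m b by (rule convex_on_affine[OF cI])
  have T: "convex_on I (gcm I f)" using convex_on_gcm[OF aff minor] .
  have Tle: "gcm I f s \<le> f s" if "s \<in> I" for s using gcm_le[OF aff minor that] .
  have tI: "t \<in> I" using I(2) interior_subset by blast
  obtain e where e: "0 < e" "cball t e \<subseteq> I" using I(2) by (meson mem_interior_cball)
  show ?thesis
    unfolding top_tangent_def
  proof (intro conjI allI impI ballI)
    fix s assume "s \<in> I"
    then show "gcm I f t + right_deriv (gcm I f) t * (s - t) \<le> f s"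
      using convex_on_right_deriv(2)[OF T I(2)] Tle by force
  next
    fix m' b' assume "\<forall>s\<in>I. m' + b' * (s - t) \<le> f s"
    then show "m' \<le> gcm I f t" using gcm_ge[OF aff _ tI, of m' b' f] by simp
  next
    fix b' assume le: "\<forall>s\<in>I. gcm I f t + b' * (s - t) \<le> f s"
    show "b' \<le> right_deriv (gcm I f) t"
    proof (rule right_deriv_ge[OF convex_on_right_deriv(1)[OF T I(2)]])
      show "t < t + e" using e by simp
      fix s assume "t < s" "s < t + e"
      then have "s \<in> I" using e by (auto simp: cball_def dist_real_def)
      then show "gcm I f t + b' * (s - t) \<le> gcm I f s"
        using gcm_ge[OF aff, of "gcm I f t" b' f s] le by simp
    qed
  qed
qed

lemma top_tangent_imp_gcm:
  assumes "is_interval I" "t \<in> interior I" "top_tangent I f t m b"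
  shows "gcm I f t = m" "right_deriv (gcm I f) t = b"
proof -
  have "top_tangent I f t (gcm I f t) (right_deriv (gcm I f) t)"
    using assms(3) by (intro gcm_top_tangent[OF assms(1,2), of m b]) (auto simp: top_tangent_def)
  from top_tangent_unique[OF this assms(3)]
  show "gcm I f t = m" "right_deriv (gcm I f) t = b" by auto
qed

text \<open>A convex minorant would have a supporting line at the interior point \<open>t\<close>.
  Without one the supremum is over the empty set at every point, so \<open>gcm I f\<close> is the
  constant \<open>Sup {}\<close>, whatever this value is.\<close>

lemma right_deriv_gcm_not_minorized:
  assumes I: "is_interval I" "t \<in> interior I"
    and no: "\<And>m b. \<exists>s\<in>I. f s < m + b * (s - t)"
  shows "right_deriv (gcm I f) t = 0"
proof -
  have "\<not> (convex_on I z \<and> (\<forall>s\<in>I. z s \<le> f s))" for z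
  proof
    assume z: "convex_on I z \<and> (\<forall>s\<in>I. z s \<le> f s)"
    obtain s where "s \<in> I" "f s < z t + right_deriv z t * (s - t)" using no by blast
    then show False using z convex_on_right_deriv(2)[of I z t s] I(2) by force
  qed
  then have "gcm I f t = Sup {}" for t unfolding gcm_def by (intro arg_cong[of _ _ Sup]) blast
  then have "gcm I f = (\<lambda>_. Sup {})" by blast
  then show ?thesis
    by (simp add: vector_derivative_within[OF _ has_vector_derivative_const])
qed

lemma top_tangent_extend:
  assumes "top_tangent I f t m b" "I \<subseteq> I'"
    and "\<And>s. s \<in> I' - I \<Longrightarrow> m + b * (s - t) \<le> f s"
  shows "top_tangent I' f t m b"
  using assms unfolding top_tangent_def by (meson DiffI subset_iff)

text \<open>The affine minorants of \<open>x\<close> on \<open>J\<close> and those of the rescaled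
  function correspond under \<open>m' \<mapsto> c * (m' - x0)\<close> and
  \<open>b' \<mapsto> c * d * (b' - b0)\<close>. Both maps are increasing, so maximality is
  preserved.\<close>

lemma top_tangent_rescale:
  assumes c: "0 < c" and d: "0 < d"
    and T: "top_tangent ((\<lambda>t. (t - t0) / d) ` J) (\<lambda>s. c * (x (t0 + s * d) - x0 - b0 * s * d)) 0 m b"
  shows "top_tangent J x t0 (x0 + m / c) (b0 + b / (c * d))"
proof -
  have eq: "(\<forall>s\<in>(\<lambda>t. (t - t0) / d) ` J. c * (m' - x0) + c * d * (b' - b0) * (s - 0) \<le>
        c * (x (t0 + s * d) - x0 - b0 * s * d)) \<longleftrightarrow>
      (\<forall>s\<in>J. m' + b' * (s - t0) \<le> x s)" (is "?L \<longleftrightarrow> ?R") for m' b'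
  proof -
    have "c * (m' - x0) + c * d * (b' - b0) * ((s - t0) / d - 0) \<le>
        c * (x (t0 + (s - t0) / d * d) - x0 - b0 * ((s - t0) / d) * d) \<longleftrightarrow>
        m' + b' * (s - t0) \<le> x s" (is "?l \<le> ?r \<longleftrightarrow> _") for s
    proof -
      have l: "?l = c * (m' - x0 + (b' - b0) * (s - t0))" using d by (simp add: field_simps)
      have "(s - t0) / d * d = s - t0" using d by simp
      then have r: "?r = c * (x s - x0 - b0 * (s - t0))" by (simp only: mult.assoc) simp
      show ?thesis unfolding l r mult_le_cancel_left_pos[OF c] by (simp add: algebra_simps)
    qed
    then show ?thesis by simp
  qed
  have inv: "c * (x0 + m / c - x0) = m" "c * d * (b0 + b / (c * d) - b0) = b"
    using c d by simp_all
  show ?thesis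
    unfolding top_tangent_def
  proof (intro conjI allI impI)
    show "\<forall>s\<in>J. x0 + m / c + (b0 + b / (c * d)) * (s - t0) \<le> x s"
      unfolding eq[symmetric] inv using T unfolding top_tangent_def by blast
  next
    fix m' b' assume "\<forall>s\<in>J. m' + b' * (s - t0) \<le> x s"
    then have "c * (m' - x0) \<le> m" unfolding eq[symmetric] using T unfolding top_tangent_def by blast
    then show "m' \<le> x0 + m / c" using c by (simp add: field_simps)
  next
    fix b' assume "\<forall>s\<in>J. x0 + m / c + b' * (s - t0) \<le> x s"
    then have "c * d * (b' - b0) \<le> b"
      unfolding eq[symmetric] inv using T unfolding top_tangent_def by blast
    then show "b' \<le> b0 + b / (c * d)" using c d by (simp add: field_simps)
  qed
qed

text \<open>At a minimiser \<open>s0\<close> the line of slope \<open>a\<close> through the graph is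
  a minorant; its height at \<open>0\<close> is at most \<open>m\<close>, and equality forces
  \<open>a \<le> b\<close>. Comparison with the top tangent at \<open>s0\<close> then decides the
  sign of \<open>s0\<close>: positive if \<open>b < a\<close>, nonpositive if \<open>a < b\<close>.
  In the latter case \<open>bdd\<close> ensures that the infimum lies below some minimiser.\<close>

lemma arg_min_pos_iff:
  fixes f :: "real \<Rightarrow> real"
  assumes T: "top_tangent UNIV f 0 m b" and ab: "b \<noteq> a"
    and cont: "(f \<longlongrightarrow> f 0) (at_right 0)"
    and ex: "\<exists>s. is_arg_min (\<lambda>s. f s - a * s) (\<lambda>_. True) s"
    and bdd: "bdd_below {s. is_arg_min (\<lambda>s. f s - a * s) (\<lambda>_. True) s}"
  shows "0 < left_arg_min (\<lambda>s. f s - a * s) \<longleftrightarrow> b < a"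
proof -
  let ?S = "{s. is_arg_min (\<lambda>s. f s - a * s) (\<lambda>_. True) s}"
  have supp: "m + b * s \<le> f s" for s using T unfolding top_tangent_def by auto
  have tang: "f s0 - a * s0 \<le> m" "f s0 - a * s0 = m \<Longrightarrow> a \<le> b" if "s0 \<in> ?S" for s0
  proof -
    have le: "\<forall>s. f s0 - a * s0 + a * (s - 0) \<le> f s"
      using that by (auto simp: is_arg_min_linorder algebra_simps)
    show "f s0 - a * s0 \<le> m" using le T unfolding top_tangent_def by blast
    show "a \<le> b" if "f s0 - a * s0 = m" using le T unfolding top_tangent_def that by blast
  qed
  show ?thesis
  proof (cases "b < a")
    case True
    have pos: "0 < s0" if s0: "s0 \<in> ?S" for s0
    proof (rule ccontr)
      assume "\<not> 0 < s0"
      then have "0 \<le> (b - a) * s0" using True by (simp add: mult_nonpos_nonpos)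
      then have "f s0 - a * s0 = m" using tang(1)[OF s0] supp[of s0] by (simp add: algebra_simps)
      then show False using tang(2)[OF s0] True by simp
    qed
    have ne: "?S \<noteq> {}" using ex by auto
    have "0 \<le> Inf ?S" using ne pos by (intro cInf_greatest) (auto intro: less_imp_le)
    \<comment> \<open>Positivity of all minimisers leaves open that they accumulate at
      \<open>0\<close>; by right continuity \<open>0\<close> would then be a minimiser
      itself.\<close>
    moreover have "Inf ?S \<noteq> 0"
    proof
      assume I0: "Inf ?S = 0"
      obtain s1 where s1: "s1 \<in> ?S" using ne by blast
      have "f 0 - a * 0 \<le> f s1 - a * s1"
      proof (rule field_le_epsilon)
        fix e :: real assume "0 < e"
        moreover have "((\<lambda>s. f s - a * s) \<longlongrightarrow> f 0 - a * 0) (at_right 0)"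
          by (intro tendsto_intros cont)
        ultimately have "\<forall>\<^sub>F s in at_right 0. dist (f s - a * s) (f 0 - a * 0) < e"
          by (rule tendstoD[rotated])
        then obtain r where r: "0 < r" "\<And>s. 0 < s \<Longrightarrow> s < r \<Longrightarrow> dist (f s - a * s) (f 0 - a * 0) < e"
          unfolding eventually_at_right_field by blast
        have "\<exists>s\<in>?S. s < r" using r(1) I0 ne by (intro cInf_lessD) auto
        then obtain s where s: "s \<in> ?S" "s < r" by blast
        have "dist (f s - a * s) (f 0 - a * 0) < e" using r(2) pos[OF s(1)] s(2) by blast
        moreover have "f s - a * s \<le> f s1 - a * s1" using s(1) by (simp add: is_arg_min_linorder)
        ultimately show "f 0 - a * 0 \<le> f s1 - a * s1 + e" by (simp add: dist_real_def)
      qed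
      then have "0 \<in> ?S" using s1 by (auto simp: is_arg_min_linorder intro: order_trans)
      then show False using pos by blast
    qed
    ultimately show ?thesis using True by (simp add: left_arg_min_def)
  next
    case False
    have neg: "s0 \<le> 0" if s0: "s0 \<in> ?S" for s0
    proof (rule ccontr)
      assume "\<not> s0 \<le> 0"
      then have "0 < (b - a) * s0" using False ab by simp
      then show False using tang(1)[OF s0] supp[of s0] by (simp add: algebra_simps)
    qed
    obtain s0 where s0: "s0 \<in> ?S" using ex by blast
    have "Inf ?S \<le> 0" using cInf_lower[OF s0 bdd] neg[OF s0] by linarith
    then show ?thesis using False by (simp add: left_arg_min_def)
  qed
qed

subsection \<open>Right-continuous functions and measurability\<close>

text \<open>Points of \<open>S\<close> that are isolated from the right have disjoint right neighbourhoods, so there are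
  only countably many of them.\<close>

lemma countable_right_dense:
  fixes S :: "real set"
  obtains D where "countable D" "D \<subseteq> S"
    "\<And>s e. s \<in> S \<Longrightarrow> s \<notin> D \<Longrightarrow> 0 < e \<Longrightarrow> \<exists>r\<in>D. s < r \<and> r < s + e"
proof -
  define iso where "iso = {s\<in>S. \<exists>e>0. \<forall>r\<in>S. \<not> (s < r \<and> r < s + e)}"
  \<comment> \<open>One point of \<open>S\<close> is selected in each rational interval that meets
    \<open>S\<close>; such points approach from the right every point of \<open>S\<close> that is
    not right isolated.\<close>
  define pick where "pick q r = (SOME u. u \<in> S \<and> q < u \<and> u < r)" for q r :: real
  define D where "D = iso \<union> {pick q r |q r. q \<in> \<rat> \<and> r \<in> \<rat> \<and> (\<exists>u\<in>S. q < u \<and> u < r)}"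
  have "\<exists>q\<in>\<rat>. s < q \<and> (\<forall>r\<in>S. s < r \<longrightarrow> q \<le> r)" if "s \<in> iso" for s
  proof -
    from that obtain e where e: "0 < e" "\<forall>r\<in>S. \<not> (s < r \<and> r < s + e)" unfolding iso_def by auto
    obtain q where "q \<in> \<rat>" "s < q" "q < s + e" using Rats_dense_in_real[of s "s + e"] e(1) by auto
    then show ?thesis using e(2) by force
  qed
  then obtain q where q: "\<And>s. s \<in> iso \<Longrightarrow> q s \<in> \<rat> \<and> s < q s \<and> (\<forall>r\<in>S. s < r \<longrightarrow> q s \<le> r)"
    by metis
  have "inj_on q iso"
  proof (rule linorder_inj_onI)
    fix s s' assume "s < s'" "s \<in> iso" "s' \<in> iso"
    moreover from this have "s' \<in> S" unfolding iso_def by blast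
    ultimately show "q s \<noteq> q s'" using q[of s] q[of s'] by fastforce
  qed auto
  moreover have "countable (q ` iso)"
    using q by (intro countable_subset[OF _ countable_rat]) blast
  ultimately have "countable iso" using countable_image_inj_on by blast
  moreover have "{pick q r |q r. q \<in> \<rat> \<and> r \<in> \<rat> \<and> (\<exists>u\<in>S. q < u \<and> u < r)} \<subseteq>
      (\<lambda>(q, r). pick q r) ` (\<rat> \<times> \<rat>)" by auto
  ultimately have "countable D" unfolding D_def
    by (meson countable_Un countable_SIGMA countable_image countable_rat countable_subset)
  moreover have pick: "pick q r \<in> S \<and> q < pick q r \<and> pick q r < r" if "\<exists>u\<in>S. q < u \<and> u < r" for q r
    using that someI_ex[of "\<lambda>u. u \<in> S \<and> q < u \<and> u < r"] unfolding pick_def by blast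
  have "D \<subseteq> S" unfolding D_def iso_def using pick by blast
  moreover have "\<exists>r\<in>D. s < r \<and> r < s + e" if s: "s \<in> S" "s \<notin> D" "0 < e" for s e
  proof -
    obtain u where u: "u \<in> S" "s < u" "u < s + e" using s unfolding D_def iso_def by blast
    obtain a where a: "a \<in> \<rat>" "s < a" "a < u" using Rats_dense_in_real[OF u(2)] by blast
    obtain b where b: "b \<in> \<rat>" "u < b" "b < s + e" using Rats_dense_in_real[OF u(3)] by blast
    have "pick a b \<in> D" unfolding D_def using a b u by blast
    then show ?thesis using pick[of a b] a b u by (intro bexI[of _ "pick a b"]) force+
  qed
  ultimately show ?thesis using that by blast
qed

text \<open>The limit is taken within \<open>S\<close>, which lets the property pass to every subset
  and hold vacuously at points of \<open>S\<close> that are isolated from the right.\<close>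

definition right_cont_on :: "real set \<Rightarrow> (real \<Rightarrow> 'a::topological_space) \<Rightarrow> bool" where
  "right_cont_on S f \<longleftrightarrow> (\<forall>s\<in>S. (f \<longlongrightarrow> f s) (at s within S \<inter> {s<..}))"

lemma right_cont_onD:
  "right_cont_on S f \<Longrightarrow> s \<in> S \<Longrightarrow> (f \<longlongrightarrow> f s) (at s within S \<inter> {s<..})"
  by (simp add: right_cont_on_def)

lemma right_cont_on_subset:
  "right_cont_on J f \<Longrightarrow> S \<subseteq> J \<Longrightarrow> right_cont_on S f"
  unfolding right_cont_on_def by (meson Int_mono order_refl subset_iff tendsto_within_subset)

lemma cadlag_on_right_cont_on: "f \<in> cadlag_on J \<Longrightarrow> right_cont_on J f"
  unfolding cadlag_on_def right_cont_on_def by blast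

lemma continuous_on_right_cont_on: "continuous_on S f \<Longrightarrow> right_cont_on S f"
  unfolding right_cont_on_def continuous_on_def by (meson inf_le1 tendsto_within_subset)

lemma right_cont_on_ereal:
  "right_cont_on S f \<Longrightarrow> right_cont_on S (\<lambda>s. ereal (f s))"
  unfolding right_cont_on_def by simp

lemma right_cont_on_uminus_ereal:
  fixes f :: "real \<Rightarrow> ereal"
  shows "right_cont_on S f \<Longrightarrow> right_cont_on S (\<lambda>s. - f s)"
  unfolding right_cont_on_def by (simp add: tendsto_uminus_ereal)

lemma right_cont_on_diff:
  fixes f g :: "real \<Rightarrow> real"
  shows "right_cont_on S f \<Longrightarrow> right_cont_on S g \<Longrightarrow> right_cont_on S (\<lambda>s. f s - g s)"
  unfolding right_cont_on_def by (simp add: tendsto_diff)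

lemma right_cont_on_abs:
  fixes f :: "real \<Rightarrow> real"
  shows "right_cont_on S f \<Longrightarrow> right_cont_on S (\<lambda>s. \<bar>f s\<bar>)"
  unfolding right_cont_on_def by (simp add: tendsto_rabs)

lemma right_cont_on_divide:
  fixes f g :: "real \<Rightarrow> real"
  shows "right_cont_on S f \<Longrightarrow> right_cont_on S g \<Longrightarrow> (\<And>s. s \<in> S \<Longrightarrow> g s \<noteq> 0) \<Longrightarrow>
    right_cont_on S (\<lambda>s. f s / g s)"
  unfolding right_cont_on_def by (simp add: tendsto_divide)

text \<open>At a point outside \<open>D\<close> the value is a limit of values at points of
  \<open>D\<close> to its right, each of which is at least the infimum over
  \<open>D\<close>.\<close>

lemma INF_right_dense:
  fixes f :: "real \<Rightarrow> ereal"
  assumes D: "D \<subseteq> S" "\<And>s e. s \<in> S \<Longrightarrow> s \<notin> D \<Longrightarrow> 0 < e \<Longrightarrow> \<exists>r\<in>D. s < r \<and> r < s + e"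
    and f: "right_cont_on S f"
  shows "(INF s\<in>S. f s) = (INF s\<in>D. f s)"
proof (rule antisym)
  show "(INF s\<in>S. f s) \<le> (INF s\<in>D. f s)" using D(1) by (intro INF_superset_mono) auto
  show "(INF s\<in>D. f s) \<le> (INF s\<in>S. f s)"
  proof (rule INF_greatest)
    fix s assume s: "s \<in> S"
    show "(INF s\<in>D. f s) \<le> f s"
    proof (cases "s \<in> D")
      case False
      show ?thesis
      proof (rule tendsto_lowerbound)
        show "(f \<longlongrightarrow> f s) (at s within D \<inter> {s<..})"
          using right_cont_onD[OF f s] D(1) by (rule_tac tendsto_within_subset) auto
        show "\<forall>\<^sub>F r in at s within D \<inter> {s<..}. (INF s\<in>D. f s) \<le> f r"
          by (auto simp: eventually_at_filter intro!: always_eventually INF_lower)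
        have "s islimpt D \<inter> {s<..}"
          unfolding islimpt_approachable using D(2)[OF s False] by (force simp: dist_real_def)
        then show "at s within D \<inter> {s<..} \<noteq> bot" by (simp add: trivial_limit_within)
      qed
    qed (rule INF_lower)
  qed
qed

text \<open>The countable set depends on \<open>S\<close> alone, so that one countable infimum
  serves all paths at once.\<close>

lemma borel_measurable_INF_right_cont:
  fixes F :: "'a \<Rightarrow> real \<Rightarrow> ereal"
  assumes "\<And>\<omega>. \<omega> \<in> space M \<Longrightarrow> right_cont_on S (F \<omega>)"
    and "\<And>s. s \<in> S \<Longrightarrow> (\<lambda>\<omega>. F \<omega> s) \<in> borel_measurable M"
  shows "(\<lambda>\<omega>. INF s\<in>S. F \<omega> s) \<in> borel_measurable M"
proof -
  obtain D where D: "countable D" "D \<subseteq> S"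
    "\<And>s e. s \<in> S \<Longrightarrow> s \<notin> D \<Longrightarrow> 0 < e \<Longrightarrow> \<exists>r\<in>D. s < r \<and> r < s + e"
    using countable_right_dense by blast
  have "(\<lambda>\<omega>. INF s\<in>D. F \<omega> s) \<in> borel_measurable M"
    using assms(2) D by (intro borel_measurable_INF) auto
  then show ?thesis
    by (rule measurable_cong[THEN iffD1, rotated]) (use INF_right_dense[OF D(2,3) assms(1)] in simp)
qed

lemma borel_measurable_SUP_right_cont:
  fixes F :: "'a \<Rightarrow> real \<Rightarrow> ereal"
  assumes "\<And>\<omega>. \<omega> \<in> space M \<Longrightarrow> right_cont_on S (F \<omega>)"
    and "\<And>s. s \<in> S \<Longrightarrow> (\<lambda>\<omega>. F \<omega> s) \<in> borel_measurable M"
  shows "(\<lambda>\<omega>. SUP s\<in>S. F \<omega> s) \<in> borel_measurable M"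
proof -
  have "(\<lambda>\<omega>. - (INF s\<in>S. - F \<omega> s)) \<in> borel_measurable M"
    using assms
    by (intro borel_measurable_uminus_ereal borel_measurable_INF_right_cont
        right_cont_on_uminus_ereal) auto
  then show ?thesis by (simp add: ereal_INF_uminus_eq)
qed

text \<open>Points to the right of \<open>t\<close> bound the slope from above by a difference
  quotient, points to the left bound it from below, and a slope exists exactly if these bounds are
  compatible. As \<open>t\<close> is interior, both sides contribute, so the infimum is finite and
  serves as the slope. The uncountable quantifier over \<open>b\<close> thus gives way to
  expressions that are measurable in the path.\<close>

lemma affine_minorant_iff:
  fixes f :: "real \<Rightarrow> real"
  assumes t: "t \<in> interior I"
  shows "(\<exists>b. \<forall>s\<in>I. m + b * (s - t) \<le> f s) \<longleftrightarrow>
    m \<le> f t \<and> (SUP s\<in>I \<inter> {..<t}. ereal ((f s - m) / (s - t))) \<le>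
      (INF s\<in>I \<inter> {t<..}. ereal ((f s - m) / (s - t)))"
    (is "_ \<longleftrightarrow> _ \<and> ?L \<le> ?R")
proof
  assume "\<exists>b. \<forall>s\<in>I. m + b * (s - t) \<le> f s"
  then obtain b where b: "\<And>s. s \<in> I \<Longrightarrow> m + b * (s - t) \<le> f s" by blast
  have "?L \<le> ereal b"
    using b by (intro SUP_least) (force simp: neg_divide_le_eq)
  also have "ereal b \<le> ?R"
    using b by (intro INF_greatest) (force simp: pos_le_divide_eq)
  finally show "m \<le> f t \<and> ?L \<le> ?R" using b[of t] t interior_subset by force
next
  assume mf: "m \<le> f t \<and> ?L \<le> ?R"
  obtain e where e: "0 < e" "cball t e \<subseteq> I" using t by (meson mem_interior_cball)
  then have pm: "t + e \<in> I \<inter> {t<..}" "t - e \<in> I \<inter> {..<t}" by (auto simp: cball_def dist_real_def)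
  have "?R \<le> ereal ((f (t + e) - m) / (t + e - t))" by (rule INF_lower[OF pm(1)])
  moreover have "ereal ((f (t - e) - m) / (t - e - t)) \<le> ?L" by (rule SUP_upper[OF pm(2)])
  ultimately have "?R \<noteq> \<infinity>" "?R \<noteq> - \<infinity>" using mf by auto
  then obtain b where b: "?R = ereal b" by (cases ?R) auto
  have "m + b * (s - t) \<le> f s" if s: "s \<in> I" for s
  proof (cases s t rule: linorder_cases)
    case less
    have "ereal ((f s - m) / (s - t)) \<le> ?L" using s less by (intro SUP_upper) auto
    also have "\<dots> \<le> ereal b" using mf b by simp
    finally have "(f s - m) / (s - t) \<le> b" by simp
    then show ?thesis using less by (simp add: neg_divide_le_eq)
  next
    case greater
    have "?R \<le> ereal ((f s - m) / (s - t))" using s greater by (intro INF_lower) auto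
    then have "b \<le> (f s - m) / (s - t)" using b by simp
    then show ?thesis using greater by (simp add: pos_le_divide_eq)
  qed (use mf in simp)
  then show "\<exists>b. \<forall>s\<in>I. m + b * (s - t) \<le> f s" by blast
qed

text \<open>A line of the same height whose slope is the infimum still lies below \<open>f\<close>:
  on the right by the choice of the slope, on the left because steepening lowers the line there.
  Maximality of \<open>b\<close> then excludes a larger infimum.\<close>

lemma top_tangent_slope:
  assumes T: "top_tangent I f t m b" and t: "t \<in> interior I"
  shows "(INF s\<in>I \<inter> {t<..}. ereal ((f s - m) / (s - t))) = ereal b"
proof (rule antisym)
  let ?R = "INF s\<in>I \<inter> {t<..}. ereal ((f s - m) / (s - t))"
  have supp: "m + b * (s - t) \<le> f s" if "s \<in> I" for s using T that unfolding top_tangent_def by blast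
  show bR: "ereal b \<le> ?R"
    using supp by (intro INF_greatest) (force simp: pos_le_divide_eq)
  obtain e where e: "0 < e" "cball t e \<subseteq> I" using t by (meson mem_interior_cball)
  then have "t + e \<in> I \<inter> {t<..}" by (auto simp: cball_def dist_real_def)
  then have "?R \<le> ereal ((f (t + e) - m) / (t + e - t))" by (rule INF_lower)
  with bR obtain c where c: "?R = ereal c" "b \<le> c" by (cases ?R) auto
  have "m + c * (s - t) \<le> f s" if s: "s \<in> I" for s
  proof (cases "s \<le> t")
    case True
    have "c * (s - t) \<le> b * (s - t)" using True c(2) by (simp add: mult_right_mono_neg)
    then show ?thesis using supp[OF s] by linarith
  next
    case False
    have "?R \<le> ereal ((f s - m) / (s - t))" using s False by (intro INF_lower) auto
    then have "c \<le> (f s - m) / (s - t)" using c by simp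
    then show ?thesis using False by (simp add: pos_le_divide_eq)
  qed
  then have "c \<le> b" using T unfolding top_tangent_def by blast
  then show "?R \<le> ereal b" using c by simp
qed

text \<open>This covers also those \<open>\<omega>\<close> for which \<open>X \<omega>\<close> has no convex minorant: there the derivative is the
  junk value 0, and the set of these \<open>\<omega>\<close> is measurable.\<close>

lemma borel_measurable_right_deriv_gcm:
  assumes I: "is_interval I" "t \<in> interior I"
    and rc: "\<And>\<omega>. \<omega> \<in> space M \<Longrightarrow> right_cont_on I (X \<omega>)"
    and meas: "\<And>s. s \<in> I \<Longrightarrow> (\<lambda>\<omega>. X \<omega> s) \<in> borel_measurable M"
  shows "(\<lambda>\<omega>. right_deriv (gcm I (X \<omega>)) t) \<in> borel_measurable M"
proof -
  define ok where "ok m \<omega> \<longleftrightarrow> (\<exists>b. \<forall>s\<in>I. m + b * (s - t) \<le> X \<omega> s)" for m \<omega>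
  have tI: "t \<in> I" using I(2) interior_subset by blast
  have rcq: "right_cont_on S (\<lambda>s. ereal ((X \<omega> s - m) / (s - t)))"
    if "\<omega> \<in> space M" "S \<subseteq> I" "t \<notin> S" for S m \<omega>
  proof -
    have X: "right_cont_on S (X \<omega>)" using right_cont_on_subset[OF rc] that by blast
    have c: "right_cont_on S (\<lambda>s. c)" "right_cont_on S (\<lambda>s. s - t)" for c :: real
      by (intro continuous_on_right_cont_on continuous_intros)+
    show ?thesis
      using that(3)
      by (intro right_cont_on_ereal right_cont_on_divide right_cont_on_diff X c) auto
  qed
  have [measurable]: "Measurable.pred M (\<lambda>\<omega>. ok m \<omega>)" for m
  proof -
    have [measurable]: "(\<lambda>\<omega>. SUP s\<in>I \<inter> {..<t}. ereal ((X \<omega> s - m) / (s - t))) \<in> borel_measurable M"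
      using meas by (intro borel_measurable_SUP_right_cont rcq) auto
    have [measurable]: "(\<lambda>\<omega>. INF s\<in>I \<inter> {t<..}. ereal ((X \<omega> s - m) / (s - t))) \<in> borel_measurable M"
      using meas by (intro borel_measurable_INF_right_cont rcq) auto
    note meas[OF tI, measurable]
    show ?thesis unfolding ok_def affine_minorant_iff[OF I(2)] by measurable
  qed
  define minor where "minor \<omega> \<longleftrightarrow> (\<exists>n::nat. ok (- real n) \<omega>)" for \<omega>
  have [measurable]: "Measurable.pred M minor" unfolding minor_def by measurable
  have ok_mono: "ok m' \<omega>" if "ok m \<omega>" "m' \<le> m" for m m' \<omega>
    using that unfolding ok_def by (meson add_right_mono order_trans)
  have minor_iff: "minor \<omega> \<longleftrightarrow> (\<exists>m. ok m \<omega>)" for \<omega>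
  proof
    assume "\<exists>m. ok m \<omega>"
    then obtain m where m: "ok m \<omega>" by blast
    obtain n where "- m \<le> real n" using real_arch_simple by blast
    then show "minor \<omega>" unfolding minor_def using ok_mono[OF m, of "- real n"] by force
  qed (auto simp: minor_def)
  have tang: "top_tangent I (X \<omega>) t (gcm I (X \<omega>) t) (right_deriv (gcm I (X \<omega>)) t)" if "minor \<omega>" for \<omega>
    using that gcm_top_tangent[OF I] unfolding minor_iff ok_def by blast
  define m where "m \<omega> = (if minor \<omega> then gcm I (X \<omega>) t else 0)" for \<omega>
  \<comment> \<open>The largest height is attained and every smaller height is admissible, so where
    a minorant exists the upper level sets of \<open>m\<close> are the events
    \<open>ok a\<close>.\<close>
  have "{\<omega>\<in>space M. a \<le> m \<omega>} = {\<omega>\<in>space M. if minor \<omega> then ok a \<omega> else a \<le> 0}" for a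
  proof -
    have "a \<le> gcm I (X \<omega>) t \<longleftrightarrow> ok a \<omega>" if "minor \<omega>" for \<omega>
      using tang[OF that] ok_mono[of "gcm I (X \<omega>) t" \<omega> a] unfolding top_tangent_def ok_def by blast
    then show ?thesis by (auto simp: m_def)
  qed
  then have [measurable]: "m \<in> borel_measurable M"
    unfolding borel_measurable_iff_ge by simp
  have [measurable]: "(\<lambda>\<omega>. INF s\<in>I \<inter> {t<..}. ereal ((X \<omega> s - m \<omega>) / (s - t))) \<in> borel_measurable M"
    using meas by (intro borel_measurable_INF_right_cont rcq) auto
  have "right_deriv (gcm I (X \<omega>)) t =
    (if minor \<omega> then real_of_ereal (INF s\<in>I \<inter> {t<..}. ereal ((X \<omega> s - m \<omega>) / (s - t))) else 0)" for \<omega>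
  proof (cases "minor \<omega>")
    case True
    then show ?thesis using top_tangent_slope[OF tang[OF True] I(2)] by (simp add: m_def)
  next
    case False
    then have "\<exists>s\<in>I. X \<omega> s < m + b * (s - t)" for m b
      unfolding minor_iff ok_def by (meson not_le)
    then show ?thesis using False right_deriv_gcm_not_minorized[OF I] by simp
  qed
  then show ?thesis by simp
qed

subsection \<open>The ball algebra\<close>

lemma space_DR_ball_algebra [simp]: "space DR_ball_algebra = DR"
  by (simp add: DR_ball_algebra_def space_measure_of_conv)

lemma borel_measurable_DR_dist:
  assumes "f \<in> DR"
  shows "DR_dist f \<in> borel_measurable DR_ball_algebra"
  unfolding borel_measurable_iff_less
proof
  fix a
  have "{DR.mball x r |x r. x \<in> DR} \<subseteq> Pow DR" by (auto simp: DR.mball_def)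
  then have "DR.mball f a \<in> sets DR_ball_algebra"
    using assms by (auto simp: DR_ball_algebra_def sets_measure_of)
  then show "{x \<in> space DR_ball_algebra. DR_dist f x < a} \<in> sets DR_ball_algebra"
    using assms by (simp add: DR.mball_def)
qed

lemma DR_cut:
  assumes f: "f \<in> DR" and g: "g \<in> DR"
  shows "(\<lambda>s. if a \<le> s \<and> s < b then f s else g s) \<in> DR"
proof -
  let ?h = "\<lambda>s. if a \<le> s \<and> s < b then f s else g s"
  have "(?h \<longlongrightarrow> ?h t) (at_right t) \<and> (\<exists>l. (?h \<longlongrightarrow> l) (at_left t))" for t
  proof
    from f g obtain lf lg where
      fr: "(f \<longlongrightarrow> f t) (at_right t)" and gr: "(g \<longlongrightarrow> g t) (at_right t)" and
      fl: "(f \<longlongrightarrow> lf) (at_left t)" and gl: "(g \<longlongrightarrow> lg) (at_left t)"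
      unfolding DR_def cadlag_on_def by fastforce
    show "(?h \<longlongrightarrow> ?h t) (at_right t)"
    proof (cases "a \<le> t \<and> t < b")
      case t: True
      then have "\<forall>\<^sub>F s in at_right t. f s = ?h s"
        unfolding eventually_at_right_field by (intro exI[of _ b]) auto
      with fr show ?thesis using t by (simp add: Lim_transform_eventually)
    next
      case t: False
      then have "\<forall>\<^sub>F s in at_right t. g s = ?h s"
        unfolding eventually_at_right_field
        by (cases "t < a"; intro exI[of _ "if t < a then a else t + 1"]) auto
      with gr show ?thesis using t Lim_transform_eventually[of g "g t" "at_right t" ?h] by auto
    qed
    show "\<exists>l. (?h \<longlongrightarrow> l) (at_left t)"
    proof (cases "a < t \<and> t \<le> b")
      case True
      then have "\<forall>\<^sub>F s in at_left t. f s = ?h s"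
        unfolding eventually_at_left_field by (intro exI[of _ a]) auto
      then show ?thesis by (intro exI[of _ lf] Lim_transform_eventually[OF fl])
    next
      case False
      then have "\<forall>\<^sub>F s in at_left t. g s = ?h s"
        unfolding eventually_at_left_field
        by (cases "t \<le> a"; intro exI[of _ "if t \<le> a then t - 1 else b"]) auto
      then show ?thesis by (intro exI[of _ lg] Lim_transform_eventually[OF gl])
    qed
  qed
  then show ?thesis unfolding DR_def cadlag_on_def by simp
qed

lemma DR_const: "(\<lambda>_. c) \<in> DR"
  unfolding DR_def cadlag_on_def by (blast intro: tendsto_const)

abbreviation sup_dist_weight :: "nat \<Rightarrow> (real \<Rightarrow> real) \<Rightarrow> (real \<Rightarrow> real) \<Rightarrow> real" where
  "sup_dist_weight k f x \<equiv> (1/2) ^ Suc k * (sup_dist (Suc k) f x / (1 + sup_dist (Suc k) f x))"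

lemma suminf_half_tail: "(\<Sum>k. (1/2::real) ^ Suc (k + K)) = (1/2) ^ K"
proof -
  have "(\<lambda>k. (1/2::real) ^ Suc K * (1/2) ^ k) sums ((1/2) ^ Suc K * (1 / (1 - 1/2)))"
    by (intro sums_mult geometric_sums) simp
  then have "(\<lambda>k. (1/2::real) ^ Suc (k + K)) sums ((1/2) ^ K)"
    by (simp add: power_add mult_ac)
  then show ?thesis by (rule sums_unique[symmetric])
qed

text \<open>Replacing \<open>f\<close> outside a neighbourhood of \<open>[- K, K]\<close> by a constant that tends to infinity
  turns all later terms of the series of \<^const>\<open>DR_dist\<close> into constants, so that the first \<open>K\<close>
  terms can be read off.\<close>

lemma borel_measurable_sum_sup_dist_weight:
  assumes f: "f \<in> DR"
  shows "(\<lambda>x. \<Sum>k<K. sup_dist_weight k f x) \<in> borel_measurable DR_ball_algebra"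
proof -
  \<comment> \<open>This point lies halfway between two windows: the first \<open>K\<close> windows
    are inside the interval on which \<open>F n\<close> equals \<open>f\<close>, while every later
    window contains \<open>c\<close>, where \<open>F n\<close> already has the value
    \<open>n\<close>.\<close>
  define c where "c = real K + 1/2"
  define F where "F n = (\<lambda>s. if - c \<le> s \<and> s < c then f s else real n)" for n
  have F: "F n \<in> DR" for n unfolding F_def by (intro DR_cut f DR_const)
  have "(\<lambda>x. (\<Sum>k<K. sup_dist_weight k f x) + (1/2) ^ K) \<in> borel_measurable DR_ball_algebra"
  proof (rule borel_measurable_LIMSEQ_real)
    show "DR_dist (F n) \<in> borel_measurable DR_ball_algebra" for n
      by (rule borel_measurable_DR_dist[OF F])
    fix x assume "x \<in> space DR_ball_algebra"
    then have x: "x \<in> DR" by simp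
    define u where "u n = \<bar>x c - real n\<bar>" for n
    have near: "sup_dist_weight k (F n) x = sup_dist_weight k f x" if "k < K" for k n
    proof -
      have "sup_dist (Suc k) (F n) x = sup_dist (Suc k) f x"
        unfolding sup_dist_def
        using that by (intro SUP_cong refl) (auto simp: F_def c_def)
      then show ?thesis by simp
    qed
    have far: "u n \<le> sup_dist (Suc (k + K)) (F n) x" for k n
      using sup_dist_upper[OF F x, of c "Suc (k + K)" n] by (simp add: F_def u_def c_def abs_minus_commute)
    have split: "DR_dist (F n) x = (\<Sum>k. sup_dist_weight (k + K) (F n) x) + (\<Sum>k<K. sup_dist_weight k f x)" for n
      using suminf_split_initial_segment[OF DR_dist_summable[OF F x], of n K] near F x
      by (simp add: DR_dist_def)
    have sm: "summable (\<lambda>k. sup_dist_weight (k + K) (F n) x)" for n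
      using summable_ignore_initial_segment[OF DR_dist_summable[OF F x]] .
    have sh: "summable (\<lambda>k. (1/2::real) ^ Suc (k + K))"
      by (intro summable_ignore_initial_segment[of "\<lambda>k. (1/2) ^ Suc k"]
          summable_Suc_iff[THEN iffD2] summable_geometric) simp
    have "(\<Sum>k. sup_dist_weight (k + K) (F n) x) \<le> (\<Sum>k. (1/2) ^ Suc (k + K))" for n
    proof (rule suminf_le[OF _ sm sh])
      fix k
      have "sup_dist (Suc (k + K)) (F n) x / (1 + sup_dist (Suc (k + K)) (F n) x) \<le> 1"
        using sup_dist_nonneg[OF F x, of "Suc (k + K)" n] by simp
      then show "sup_dist_weight (k + K) (F n) x \<le> (1/2) ^ Suc (k + K)"
        by (intro mult_left_le) auto
    qed
    then have up: "(\<Sum>k. sup_dist_weight (k + K) (F n) x) \<le> (1/2) ^ K" for n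
      unfolding suminf_half_tail .
    have "(\<Sum>k. (1/2) ^ Suc (k + K) * (u n / (1 + u n))) \<le> (\<Sum>k. sup_dist_weight (k + K) (F n) x)" for n
    proof (rule suminf_le[OF _ summable_mult2[OF sh] sm])
      fix k
      have "u n / (1 + u n) \<le> sup_dist (Suc (k + K)) (F n) x / (1 + sup_dist (Suc (k + K)) (F n) x)"
        using frac_subadditive[OF _ order_refl _, of "sup_dist (Suc (k + K)) (F n) x" "u n"] far[of n k]
        by (simp add: u_def)
      then show "(1/2) ^ Suc (k + K) * (u n / (1 + u n)) \<le> sup_dist_weight (k + K) (F n) x"
        by (intro mult_left_mono) auto
    qed
    then have low: "(1/2) ^ K * (u n / (1 + u n)) \<le> (\<Sum>k. sup_dist_weight (k + K) (F n) x)" for n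
      unfolding suminf_mult2[OF sh, symmetric] suminf_half_tail .
    have "filterlim u at_top sequentially"
      unfolding u_def
      by (rule filterlim_at_top_mono[OF filterlim_tendsto_add_at_top[OF tendsto_const[of "- x c"] filterlim_real_sequentially]])
        (auto intro!: always_eventually)
    then have "filterlim (\<lambda>n. 1 + u n) at_top sequentially"
      by (rule filterlim_tendsto_add_at_top[OF tendsto_const])
    then have "(\<lambda>n. 1 - inverse (1 + u n)) \<longlonglongrightarrow> 1 - 0"
      by (intro tendsto_diff tendsto_const tendsto_inverse_0_at_top)
    moreover have "1 - inverse (1 + u n) = u n / (1 + u n)" for n
      by (simp add: u_def field_simps)
    ultimately have "(\<lambda>n. u n / (1 + u n)) \<longlonglongrightarrow> 1" by simp
    from tendsto_mult_left[OF this, of "(1/2) ^ K"]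
    have lim: "(\<lambda>n. (1/2) ^ K * (u n / (1 + u n))) \<longlonglongrightarrow> (1/2) ^ K" unfolding mult_1_right .
    have "(\<lambda>n. \<Sum>k. sup_dist_weight (k + K) (F n) x) \<longlonglongrightarrow> (1/2) ^ K"
    proof (rule tendsto_sandwich[OF _ _ lim tendsto_const])
      show "\<forall>\<^sub>F n in sequentially. (1/2) ^ K * (u n / (1 + u n)) \<le> (\<Sum>k. sup_dist_weight (k + K) (F n) x)"
        by (rule always_eventually) (rule allI, rule low)
      show "\<forall>\<^sub>F n in sequentially. (\<Sum>k. sup_dist_weight (k + K) (F n) x) \<le> (1/2) ^ K"
        by (rule always_eventually) (rule allI, rule up)
    qed
    then have "(\<lambda>n. (\<Sum>k. sup_dist_weight (k + K) (F n) x) + (\<Sum>k<K. sup_dist_weight k f x))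
        \<longlonglongrightarrow> (1/2) ^ K + (\<Sum>k<K. sup_dist_weight k f x)"
      by (intro tendsto_add tendsto_const)
    then show "(\<lambda>n. DR_dist (F n) x) \<longlonglongrightarrow> (\<Sum>k<K. sup_dist_weight k f x) + (1/2) ^ K"
      unfolding split by (simp add: add.commute)
  qed
  from borel_measurable_diff[OF this borel_measurable_const[of "(1/2) ^ K"]]
  show ?thesis by simp
qed

text \<open>Consecutive partial sums differ by a single term, which yields
  \<open>q = u / (1 + u)\<close> with \<open>u\<close> the sup distance; this relation is inverted
  by \<open>u = q / (1 - q)\<close>.\<close>

lemma borel_measurable_sup_dist:
  assumes f: "f \<in> DR"
  shows "sup_dist (Suc K) f \<in> borel_measurable DR_ball_algebra"
proof -
  note borel_measurable_sum_sup_dist_weight[OF f, measurable]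
  define q where
    "q x = 2 ^ Suc K * ((\<Sum>k<Suc K. sup_dist_weight k f x) - (\<Sum>k<K. sup_dist_weight k f x))" for x
  have [measurable]: "q \<in> borel_measurable DR_ball_algebra" unfolding q_def by measurable
  have "q x / (1 - q x) = sup_dist (Suc K) f x" if "x \<in> DR" for x
  proof -
    have "q x = (2 ^ Suc K * (1/2) ^ Suc K) * (sup_dist (Suc K) f x / (1 + sup_dist (Suc K) f x))"
      by (simp add: q_def del: power_Suc)
    also have "2 ^ Suc K * (1/2) ^ Suc K = (1::real)"
      by (simp only: power_mult_distrib[symmetric]) simp
    finally show ?thesis
    proof -
      assume q: "q x = 1 * (sup_dist (Suc K) f x / (1 + sup_dist (Suc K) f x))"
      have "1 - q x = 1 / (1 + sup_dist (Suc K) f x)"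
        using sup_dist_nonneg[OF f that, of "Suc K"] by (simp add: q field_simps)
      then show ?thesis using sup_dist_nonneg[OF f that, of "Suc K"] by (simp add: q)
    qed
  qed
  then have "sup_dist (Suc K) f \<in> borel_measurable DR_ball_algebra \<longleftrightarrow>
      (\<lambda>x. q x / (1 - q x)) \<in> borel_measurable DR_ball_algebra"
    by (intro measurable_cong) simp
  moreover have "(\<lambda>x. q x / (1 - q x)) \<in> borel_measurable DR_ball_algebra" by measurable
  ultimately show ?thesis by (rule iffD2)
qed

lemma sup_dist_le_iff:
  assumes "x \<in> DR" "y \<in> DR"
  shows "sup_dist k x y \<le> r \<longleftrightarrow> (\<forall>s\<in>{- real k..real k}. \<bar>x s - y s\<bar> \<le> r)"
  unfolding sup_dist_def using sup_dist_bdd[OF assms] by (subst cSUP_le_iff) auto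

text \<open>The function \<open>F n\<close> is a spike on a short interval starting at
  \<open>t\<close>, so high that distance at most \<open>n\<close> from it forces \<open>x t\<close>
  above \<open>a\<close>. Conversely, if \<open>a < x t\<close>, right continuity keeps
  \<open>x\<close> uniformly above \<open>a\<close> along a short spike, and boundedness on the
  window brings \<open>x\<close> within distance \<open>n\<close> for large
  \<open>n\<close>.\<close>

lemma borel_measurable_DR_eval:
  "(\<lambda>x. x t) \<in> borel_measurable DR_ball_algebra"
  unfolding borel_measurable_iff_greater
proof
  fix a :: real
  obtain K where K: "\<bar>t\<bar> \<le> real K" using real_arch_simple by blast
  define F where
    "F n = (\<lambda>s. if t \<le> s \<and> s < t + 1 / real (Suc n) then a + real n + 1 / real (Suc n) else 0)" for n
  have F: "F n \<in> DR" for n unfolding F_def by (intro DR_cut DR_const)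
  have "{x \<in> DR. a < x t} = (\<Union>n. {x \<in> DR. sup_dist (Suc K) (F n) x \<le> real n})"
  proof (intro equalityI subsetI)
    fix x assume "x \<in> {x \<in> DR. a < x t}"
    then have x: "x \<in> DR" and xt: "a < x t" by auto
    obtain B where B: "\<forall>s\<in>{- real (Suc K)..real (Suc K)}. \<bar>x s\<bar> \<le> B"
      using DR_bounded_on_interval[OF x] by blast
    obtain b where b: "a < b" "b < x t" using dense[OF xt] by blast
    have "(x \<longlongrightarrow> x t) (at_right t)"
      using right_cont_onD[OF cadlag_on_right_cont_on, of x UNIV t] x by (simp add: DR_def)
    then have "\<forall>\<^sub>F s in at_right t. b < x s" using b(2) by (rule order_tendstoD)
    then obtain r where r: "t < r" "\<And>s. t < s \<Longrightarrow> s < r \<Longrightarrow> b < x s"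
      unfolding eventually_at_right_field by blast
    obtain n1 where n1: "inverse (real (Suc n1)) < min (r - t) (b - a)"
      using reals_Archimedean[of "min (r - t) (b - a)"] r(1) b(1) by auto
    obtain n2 where n2: "\<bar>a\<bar> + B \<le> real n2" using real_arch_simple by blast
    define n where "n = max n1 n2"
    have "1 / real (Suc n) \<le> inverse (real (Suc n1))"
      by (simp add: n_def field_simps)
    then have n: "1 / real (Suc n) < r - t" "1 / real (Suc n) < b - a" "\<bar>a\<bar> + B \<le> real n"
      using n1 n2 by (auto simp: n_def)
    have "\<bar>F n s - x s\<bar> \<le> real n" if s: "s \<in> {- real (Suc K)..real (Suc K)}" for s
    proof (cases "t \<le> s \<and> s < t + 1 / real (Suc n)")
      case True
      then have "b \<le> x s" using r(2)[of s] b(2) n(1) by (cases "s = t") auto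
      moreover have "\<bar>x s\<bar> \<le> B" using B s by blast
      moreover have "0 < 1 / real (Suc n)" by simp
      moreover have "F n s = a + real n + 1 / real (Suc n)" using True by (simp add: F_def)
      ultimately show ?thesis using n(2,3) by linarith
    next
      case False
      then have "F n s = 0" unfolding F_def by (rule if_not_P)
      moreover have "\<bar>x s\<bar> \<le> B" using B s by blast
      ultimately show ?thesis using n(3) by linarith
    qed
    then have "sup_dist (Suc K) (F n) x \<le> real n" unfolding sup_dist_le_iff[OF F x] by (rule ballI)
    then show "x \<in> (\<Union>n. {x \<in> DR. sup_dist (Suc K) (F n) x \<le> real n})"
      using x by blast
  next
    fix x assume "x \<in> (\<Union>n. {x \<in> DR. sup_dist (Suc K) (F n) x \<le> real n})"
    then obtain n where x: "x \<in> DR" and n: "sup_dist (Suc K) (F n) x \<le> real n" by blast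
    have "t \<in> {- real (Suc K)..real (Suc K)}" using K by auto
    then have "\<bar>F n t - x t\<bar> \<le> real n" using sup_dist_upper[OF F x] n by (meson order_trans)
    moreover have "F n t = a + real n + 1 / real (Suc n)" by (simp add: F_def)
    moreover have "0 < 1 / real (Suc n)" by simp
    ultimately have "a < x t" by linarith
    then show "x \<in> {x \<in> DR. a < x t}" using x by simp
  qed
  moreover have "{x \<in> DR. sup_dist (Suc K) (F n) x \<le> real n} \<in> sets DR_ball_algebra" for n
    using borel_measurable_sup_dist[OF F, of K n] unfolding borel_measurable_iff_le space_DR_ball_algebra
    by blast
  then have "(\<Union>n. {x \<in> DR. sup_dist (Suc K) (F n) x \<le> real n}) \<in> sets DR_ball_algebra"
    by (intro sets.countable_UN) blast
  ultimately show "{x \<in> space DR_ball_algebra. a < x t} \<in> sets DR_ball_algebra"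
    by (simp only: space_DR_ball_algebra)
qed

text \<open>For \<open>x\<close> in \<open>DR\<close> and continuous \<open>w\<close> this is the
  least \<open>B\<close> with \<open>\<bar>x s\<bar> \<le> B + w s\<close> on the window.
  Subtracting the weight permits bounds whose constant stays the same as the window grows.\<close>

definition sup_excess :: "nat \<Rightarrow> (real \<Rightarrow> real) \<Rightarrow> (real \<Rightarrow> real) \<Rightarrow> real" where
  "sup_excess k w x = (SUP s\<in>{- real k..real k}. \<bar>x s\<bar> - w s)"

lemma sup_excess_le_iff:
  assumes x: "x \<in> DR" and w: "continuous_on UNIV w"
  shows "sup_excess k w x \<le> b \<longleftrightarrow> (\<forall>s\<in>{- real k..real k}. \<bar>x s\<bar> - w s \<le> b)"
proof -
  obtain B where B: "\<forall>s\<in>{- real k..real k}. \<bar>x s\<bar> \<le> B" using DR_bounded_on_interval[OF x] by blast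
  have "compact (w ` {- real k..real k})"
    using w by (intro compact_continuous_image continuous_on_subset[OF w]) auto
  then obtain C where C: "\<forall>s\<in>{- real k..real k}. \<bar>w s\<bar> \<le> C"
    using compact_imp_bounded[of "w ` {- real k..real k}"] unfolding bounded_iff by auto
  have "\<bar>x s\<bar> - w s \<le> B + C" if "s \<in> {- real k..real k}" for s
    using B[rule_format, OF that] C[rule_format, OF that] by linarith
  then have "bdd_above ((\<lambda>s. \<bar>x s\<bar> - w s) ` {- real k..real k})" by (intro bdd_aboveI2)
  then show ?thesis unfolding sup_excess_def by (subst cSUP_le_iff) auto
qed

lemma right_cont_on_DR: "x \<in> DR \<Longrightarrow> right_cont_on S x"
  unfolding DR_def using cadlag_on_right_cont_on right_cont_on_subset by blast

lemma borel_measurable_sup_excess: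
  assumes w: "continuous_on UNIV w"
  shows "sup_excess k w \<in> borel_measurable DR_ball_algebra"
  unfolding borel_measurable_iff_le
proof
  fix b
  note borel_measurable_DR_eval[measurable]
  have wc: "right_cont_on {- real k..real k} w"
    using w continuous_on_right_cont_on continuous_on_subset by blast
  have m: "(\<lambda>x. SUP s\<in>{- real k..real k}. ereal (\<bar>x s\<bar> - w s)) \<in> borel_measurable DR_ball_algebra"
    by (intro borel_measurable_SUP_right_cont right_cont_on_ereal right_cont_on_diff
        right_cont_on_abs wc right_cont_on_DR) auto
  have iff: "sup_excess k w x \<le> b \<longleftrightarrow> (SUP s\<in>{- real k..real k}. ereal (\<bar>x s\<bar> - w s)) \<in> {..ereal b}"
    if "x \<in> DR" for x
    by (simp only: sup_excess_le_iff[OF that w] SUP_le_iff ereal_less_eq atMost_iff)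
  show "{x \<in> space DR_ball_algebra. sup_excess k w x \<le> b} \<in> sets DR_ball_algebra"
    using measurable_sets[OF m, of "{..ereal b}"]
    by (simp only: vimage_def Int_def mem_Collect_eq space_DR_ball_algebra iff conj_commute[of _ "_ \<in> DR"]
        cong: conj_cong) simp
qed

lemma sup_excess_le_add:
  assumes x: "x \<in> DR" and y: "y \<in> DR" and w: "continuous_on UNIV w"
  shows "sup_excess k w x \<le> sup_excess k w y + sup_dist k x y"
  unfolding sup_excess_le_iff[OF x w]
proof
  fix s assume s: "s \<in> {- real k..real k}"
  have "\<bar>y s\<bar> - w s \<le> sup_excess k w y"
    using sup_excess_le_iff[OF y w, of k "sup_excess k w y"] s by simp
  then show "\<bar>x s\<bar> - w s \<le> sup_excess k w y + sup_dist k x y"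
    using sup_dist_upper[OF x y s] by linarith
qed

lemma sup_dist_weight_le_DR_dist:
  assumes "x \<in> DR" "y \<in> DR"
  shows "sup_dist_weight k x y \<le> DR_dist x y"
proof -
  have "0 \<le> sup_dist_weight j x y" for j using sup_dist_nonneg[OF assms, of "Suc j"] by simp
  then have "(\<Sum>j\<in>{k}. sup_dist_weight j x y) \<le> (\<Sum>j. sup_dist_weight j x y)"
    by (intro sum_le_suminf DR_dist_summable assms) auto
  then show ?thesis using assms by (simp add: DR_dist_def)
qed

text \<open>A continuous replacement for the indicator of an excess above \<open>B\<close>: it
  vanishes up to \<open>B\<close> and equals \<open>1\<close> from \<open>B + 1\<close> on, which
  makes it an admissible bounded test function.\<close>

definition excess_test :: "nat \<Rightarrow> (real \<Rightarrow> real) \<Rightarrow> real \<Rightarrow> (real \<Rightarrow> real) \<Rightarrow> real" where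
  "excess_test k w B x = min 1 (max 0 (sup_excess (Suc k) w x - B))"

text \<open>The cutoff changes by at most \<open>min 1 u\<close>, with \<open>u\<close> the sup
  distance on the window, and \<open>min 1 u \<le> 2 * (u / (1 + u))\<close>. Dividing by the weight
  \<open>(1/2) ^ Suc k\<close> of the corresponding term of the series produces the
  constant.\<close>

lemma excess_test_Lipschitz:
  assumes x: "x \<in> DR" and y: "y \<in> DR" and w: "continuous_on UNIV w"
  shows "\<bar>excess_test k w B x - excess_test k w B y\<bar> \<le> 2 ^ (k + 2) * DR_dist x y"
proof -
  define u where "u = sup_dist (Suc k) x y"
  have u: "0 \<le> u" using sup_dist_nonneg[OF x y] by (simp add: u_def)
  have sym: "sup_dist (Suc k) y x = u" by (simp add: u_def sup_dist_def abs_minus_commute)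
  have "\<bar>excess_test k w B x - excess_test k w B y\<bar> \<le> min 1 u"
    using sup_excess_le_add[OF x y w, of "Suc k"] sup_excess_le_add[OF y x w, of "Suc k"] u
    unfolding excess_test_def sym u_def[symmetric] by linarith
  also have "\<dots> \<le> 2 * (u / (1 + u))"
  proof -
    have "min 1 u * (1 + u) \<le> 2 * u"
    proof (cases "u \<le> 1")
      case True
      then have "u * u \<le> u * 1" using u by (intro mult_left_mono)
      then show ?thesis using True by (simp add: distrib_left)
    qed simp
    then show ?thesis using u by (simp add: pos_le_divide_eq)
  qed
  also have "\<dots> = 2 ^ (k + 2) * sup_dist_weight k x y"
  proof -
    have "2 ^ (k + 2) * (1/2) ^ Suc k = 2 * (2 ^ Suc k * (1/2) ^ Suc k :: real)" by simp
    also have "2 ^ Suc k * (1/2) ^ Suc k = (1::real)"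
      by (simp only: power_mult_distrib[symmetric]) simp
    finally show ?thesis unfolding u_def mult.assoc[symmetric] by simp
  qed
  also have "\<dots> \<le> 2 ^ (k + 2) * DR_dist x y"
    using sup_dist_weight_le_DR_dist[OF x y] by (intro mult_left_mono) auto
  finally show ?thesis .
qed

lemma continuous_map_excess_test:
  assumes w: "continuous_on UNIV w"
  shows "continuous_map DR.mtopology euclideanreal (excess_test k w B)"
proof -
  have "continuous_map DR.mtopology Met_TC.mtopology (excess_test k w B)"
    unfolding DR.metric_continuous_map[OF Met_TC.Metric_space_axioms]
  proof (intro conjI ballI allI impI)
    fix a and e :: real assume a: "a \<in> DR" and e: "0 < e"
    have "dist (excess_test k w B a) (excess_test k w B x) < e"
      if "x \<in> DR" "DR_dist a x < e / 2 ^ (k + 2)" for x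
    proof -
      have "2 ^ (k + 2) * DR_dist a x < e" using that(2) by (simp add: field_simps)
      then show ?thesis
        using excess_test_Lipschitz[OF a that(1) w, of k B] by (simp add: dist_real_def)
    qed
    moreover have "0 < e / 2 ^ (k + 2)" using e by simp
    ultimately show "\<exists>r>0. \<forall>x. x \<in> DR \<and> DR_dist a x < r \<longrightarrow>
        dist (excess_test k w B a) (excess_test k w B x) < e" by blast
  qed simp
  then show ?thesis by simp
qed

text \<open>A portmanteau argument by sandwiching: along \<open>Y\<close> the test function is at
  most the indicator of the complement of \<open>E\<close>, along \<open>X n\<close> it is at least
  that of the complement of \<open>G n\<close>. The ramp of the test function accounts for
  \<open>B + 1\<close>; doubling \<open>\<delta>\<close> supplies the strict inequality that
  convergence of the integrals needs.\<close>

lemma conv_in_distr_DR_excess: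
  assumes conv: "conv_in_distr_DR M X N Y"
    and prob: "\<And>n. prob_space (M n)" "prob_space N"
    and w: "continuous_on UNIV w"
    and E: "E \<in> sets N" "1 - \<delta> \<le> measure N E" "\<And>\<omega>. \<omega> \<in> E \<Longrightarrow> \<forall>s\<in>{- real (Suc k)..real (Suc k)}. \<bar>Y \<omega> s\<bar> \<le> B + w s"
    and \<delta>: "0 < \<delta>"
  defines "G \<equiv> \<lambda>n. {\<omega>\<in>space (M n). \<forall>s\<in>{- real (Suc k)..real (Suc k)}. \<bar>X n \<omega> s\<bar> \<le> B + 1 + w s}"
  shows "G n \<in> sets (M n)" "\<forall>\<^sub>F n in sequentially. 1 - 2 * \<delta> < measure (M n) (G n)"
proof -
  interpret N: prob_space N by fact
  interpret M: prob_space "M n" for n by fact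
  note borel_measurable_sup_excess[OF w, measurable]
  have X[measurable]: "X n \<in> M n \<rightarrow>\<^sub>M DR_ball_algebra" for n
    using conv unfolding conv_in_distr_DR_def by blast
  have Y[measurable]: "Y \<in> N \<rightarrow>\<^sub>M DR_ball_algebra"
    using conv unfolding conv_in_distr_DR_def by blast
  have XD: "X n \<omega> \<in> DR" if "\<omega> \<in> space (M n)" for n \<omega> using measurable_space[OF X that] by simp
  have YD: "Y \<omega> \<in> DR" if "\<omega> \<in> space N" for \<omega> using measurable_space[OF Y that] by simp
  have G: "G n = {\<omega>\<in>space (M n). sup_excess (Suc k) w (X n \<omega>) \<le> B + 1}" for n
    unfolding G_def using sup_excess_le_iff[OF XD w, of _ n "Suc k" "B + 1"] by (auto simp: algebra_simps)
  show Gm[measurable]: "G n \<in> sets (M n)" for n unfolding G by measurable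
  let ?f = "excess_test k w B"
  have f[measurable]: "?f \<in> borel_measurable DR_ball_algebra"
    unfolding excess_test_def[abs_def] by measurable
  have f01: "0 \<le> ?f x" "?f x \<le> 1" for x by (auto simp: excess_test_def)
  have lim: "(\<lambda>n. integral\<^sup>L (M n) (\<lambda>\<omega>. ?f (X n \<omega>))) \<longlonglongrightarrow> integral\<^sup>L N (\<lambda>\<omega>. ?f (Y \<omega>))"
  proof (rule conv[unfolded conv_in_distr_DR_def, THEN conjunct2, THEN conjunct2, rule_format],
      intro conjI)
    show "\<exists>C. \<forall>x\<in>DR. \<bar>?f x\<bar> \<le> C" using f01 by (intro exI[of _ 1]) simp
  qed (fact continuous_map_excess_test[OF w] f)+
  have "integral\<^sup>L N (\<lambda>\<omega>. ?f (Y \<omega>)) \<le> integral\<^sup>L N (indicator (space N - E))"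
  proof (rule integral_mono)
    show "integrable N (\<lambda>\<omega>. ?f (Y \<omega>))"
      using f01 by (intro N.integrable_const_bound[where B=1]) auto
    show "integrable N (indicator (space N - E) :: _ \<Rightarrow> real)"
      using E(1) by (intro integrable_real_indicator) (auto simp: N.emeasure_eq_measure)
    fix \<omega> assume \<omega>: "\<omega> \<in> space N"
    show "?f (Y \<omega>) \<le> indicator (space N - E) \<omega>"
    proof (cases "\<omega> \<in> E")
      case True
      then have "sup_excess (Suc k) w (Y \<omega>) \<le> B"
        using E(3)[OF True] sup_excess_le_iff[OF YD[OF \<omega>] w] by (simp add: algebra_simps)
      then show ?thesis using True by (simp add: excess_test_def)
    qed (use \<omega> f01 in auto)
  qed
  also have "\<dots> = 1 - measure N E" using E(1) by (simp add: N.prob_compl)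
  also have "\<dots> < 2 * \<delta>" using E(2) \<delta> by simp
  finally have "\<forall>\<^sub>F n in sequentially. integral\<^sup>L (M n) (\<lambda>\<omega>. ?f (X n \<omega>)) < 2 * \<delta>"
    using lim by (simp add: order_tendstoD)
  then show "\<forall>\<^sub>F n in sequentially. 1 - 2 * \<delta> < measure (M n) (G n)"
  proof eventually_elim
    case (elim n)
    have "measure (M n) (space (M n) - G n) = integral\<^sup>L (M n) (indicator (space (M n) - G n))" by simp
    also have "\<dots> \<le> integral\<^sup>L (M n) (\<lambda>\<omega>. ?f (X n \<omega>))"
    proof (rule integral_mono)
      show "integrable (M n) (\<lambda>\<omega>. ?f (X n \<omega>))"
        using f01 by (intro M.integrable_const_bound[where B=1]) auto
      show "integrable (M n) (indicator (space (M n) - G n) :: _ \<Rightarrow> real)"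
        by (intro integrable_real_indicator) (auto simp: M.emeasure_eq_measure)
      fix \<omega> assume "\<omega> \<in> space (M n)"
      then show "indicator (space (M n) - G n) \<omega> \<le> ?f (X n \<omega>)"
        using f01 by (auto simp: indicator_def G excess_test_def)
    qed
    finally show ?case using elim M.prob_compl[OF Gm, of n] by simp
  qed
qed

subsection \<open>Localisation\<close>

text \<open>The two exponentials agree on \<open>G\<close>, and elsewhere they differ by at most
  \<open>2\<close>, both having modulus one.\<close>

lemma char_diff_le:
  assumes "prob_space M" and X: "X \<in> borel_measurable M" and Z: "Z \<in> borel_measurable M"
    and G: "G \<in> sets M" and eq: "\<And>\<omega>. \<omega> \<in> G \<Longrightarrow> X \<omega> = Z \<omega>"
  shows "cmod (char (distr M borel X) t - char (distr M borel Z) t) \<le> 2 * (1 - measure M G)"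
proof -
  interpret prob_space M by fact
  note X[measurable] Z[measurable]
  have char: "char (distr M borel W) t = (CLINT \<omega>|M. iexp (t * W \<omega>))"
    if [measurable]: "W \<in> borel_measurable M" for W :: "'a \<Rightarrow> real"
    unfolding char_def by (intro integral_distr) measurable
  have int: "complex_integrable M (\<lambda>\<omega>. iexp (t * W \<omega>))"
    if [measurable]: "W \<in> borel_measurable M" for W :: "'a \<Rightarrow> real"
    by (intro integrable_const_bound[where B=1]) auto
  have eq_int: "char (distr M borel X) t - char (distr M borel Z) t =
      (CLINT \<omega>|M. iexp (t * X \<omega>) - iexp (t * Z \<omega>))"
    unfolding char[OF X] char[OF Z] using int[OF X] int[OF Z]
    by (rule Bochner_Integration.integral_diff[symmetric])
  have diff: "complex_integrable M (\<lambda>\<omega>. iexp (t * X \<omega>) - iexp (t * Z \<omega>))"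
    using int[OF X] int[OF Z] by (rule Bochner_Integration.integrable_diff)
  have "cmod (CLINT \<omega>|M. iexp (t * X \<omega>) - iexp (t * Z \<omega>)) \<le>
      (\<integral>\<omega>. cmod (iexp (t * X \<omega>) - iexp (t * Z \<omega>)) \<partial>M)"
    by (rule integral_norm_bound)
  also have "\<dots> \<le> (\<integral>\<omega>. 2 * indicator (space M - G) \<omega> \<partial>M)"
  proof (rule integral_mono)
    show "integrable M (\<lambda>\<omega>. cmod (iexp (t * X \<omega>) - iexp (t * Z \<omega>)))"
      using diff by (rule integrable_norm)
    show "integrable M (\<lambda>\<omega>. 2 * indicator (space M - G) \<omega> :: real)"
      using G by (intro integrable_mult_right integrable_real_indicator) (auto simp: emeasure_eq_measure)
    fix \<omega> assume \<omega>: "\<omega> \<in> space M"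
    show "cmod (iexp (t * X \<omega>) - iexp (t * Z \<omega>)) \<le> 2 * indicator (space M - G) \<omega>"
    proof (cases "\<omega> \<in> G")
      case True
      then show ?thesis by (simp add: eq)
    next
      case False
      have "cmod (iexp (t * X \<omega>) - iexp (t * Z \<omega>)) \<le> cmod (iexp (t * X \<omega>)) + cmod (iexp (t * Z \<omega>))"
        by (rule norm_triangle_ineq4)
      then show ?thesis using False \<omega> by simp
    qed
  qed
  also have "\<dots> = 2 * (1 - measure M G)" using G by (simp add: prob_compl)
  finally show ?thesis unfolding eq_int .
qed

text \<open>Characteristic functions replace the usual approximation theorem for weak convergence: if
  \<open>X = Z\<close> outside an event of small probability, then the characteristic functions are uniformly
  close, and Levy's continuity theorem applies.\<close>

lemma conv_in_distr_approx:
  assumes prob: "\<And>n. prob_space (M n)" "prob_space N"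
    and X: "\<And>n. X n \<in> borel_measurable (M n)" and Y: "Y \<in> borel_measurable N"
    and approx: "\<And>e. 0 < e \<Longrightarrow> \<exists>Z W. conv_in_distr M Z N W \<and>
      (\<forall>\<^sub>F n in sequentially. \<exists>G\<in>sets (M n). 1 - e < measure (M n) G \<and> (\<forall>\<omega>\<in>G. X n \<omega> = Z n \<omega>)) \<and>
      (\<exists>E\<in>sets N. 1 - e < measure N E \<and> (\<forall>\<omega>\<in>E. Y \<omega> = W \<omega>))"
  shows "conv_in_distr M X N Y"
  unfolding conv_in_distr_def
proof (intro conjI allI)
  show "weak_conv_m (\<lambda>n. distr (M n) borel (X n)) (distr N borel Y)"
  proof (rule levy_continuity)
    show "real_distribution (distr (M n) borel (X n))" for n
      by (rule prob_space.real_distribution_distr[OF prob(1) X])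
    show "real_distribution (distr N borel Y)"
      by (rule prob_space.real_distribution_distr[OF prob(2) Y])
    fix t
    show "(\<lambda>n. char (distr (M n) borel (X n)) t) \<longlonglongrightarrow> char (distr N borel Y) t"
    proof (rule tendstoI)
      fix e :: real assume e: "0 < e"
      \<comment> \<open>Each passage between a variable and its approximation costs less than
        \<open>2 * (e / 5)\<close>, and the convergence of the approximations costs the remaining
        \<open>e / 5\<close>.\<close>
      then have "0 < e / 5" by simp
      from approx[OF this] obtain Z W E where ZW: "conv_in_distr M Z N W"
        and G: "\<forall>\<^sub>F n in sequentially. \<exists>G\<in>sets (M n). 1 - e / 5 < measure (M n) G \<and> (\<forall>\<omega>\<in>G. X n \<omega> = Z n \<omega>)"
        and E: "E \<in> sets N" "1 - e / 5 < measure N E" "\<And>\<omega>. \<omega> \<in> E \<Longrightarrow> Y \<omega> = W \<omega>"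
        by blast
      have Z: "Z n \<in> borel_measurable (M n)" and W: "W \<in> borel_measurable N" for n
        using ZW unfolding conv_in_distr_def by auto
      have "(\<lambda>n. char (distr (M n) borel (Z n)) t) \<longlonglongrightarrow> char (distr N borel W) t"
        using ZW unfolding conv_in_distr_def
        by (intro levy_continuity1 prob_space.real_distribution_distr prob Z W) auto
      then have "\<forall>\<^sub>F n in sequentially.
          dist (char (distr (M n) borel (Z n)) t) (char (distr N borel W) t) < e / 5"
        using e by (intro tendstoD) auto
      with G show "\<forall>\<^sub>F n in sequentially.
          dist (char (distr (M n) borel (X n)) t) (char (distr N borel Y) t) < e"
      proof eventually_elim
        case (elim n)
        then obtain G where G: "G \<in> sets (M n)" "1 - e / 5 < measure (M n) G"
          "\<And>\<omega>. \<omega> \<in> G \<Longrightarrow> X n \<omega> = Z n \<omega>" by blast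
        have "dist (char (distr (M n) borel (X n)) t) (char (distr (M n) borel (Z n)) t) < 2 * (e / 5)"
          using char_diff_le[OF prob(1) X Z G(1,3), where t=t] G(2) by (simp add: dist_norm)
        moreover have "dist (char (distr N borel Y) t) (char (distr N borel W) t) < 2 * (e / 5)"
          using char_diff_le[OF prob(2) Y W E(1,3), where t=t] E(2) by (simp add: dist_norm)
        moreover note elim(2)
        moreover have "dist (char (distr (M n) borel (X n)) t) (char (distr N borel Y) t) \<le>
            dist (char (distr (M n) borel (X n)) t) (char (distr (M n) borel (Z n)) t) +
            dist (char (distr (M n) borel (Z n)) t) (char (distr N borel Y) t)"
          by (rule dist_triangle)
        moreover have "dist (char (distr (M n) borel (Z n)) t) (char (distr N borel Y) t) \<le>
            dist (char (distr (M n) borel (Z n)) t) (char (distr N borel W) t) +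
            dist (char (distr N borel Y) t) (char (distr N borel W) t)"
          by (rule dist_triangle2)
        ultimately show ?case by linarith
      qed
    qed
  qed
qed (fact X Y)+

lemma powr_growth:
  fixes p a C :: real
  assumes "1 < p" "0 < a"
  obtains \<tau> where "1 \<le> \<tau>" "\<And>s. \<tau> \<le> \<bar>s\<bar> \<Longrightarrow> C * \<bar>s\<bar> \<le> a * \<bar>s\<bar> powr p"
proof -
  define D where "D = max 0 (C / a)"
  define \<tau> where "\<tau> = max 1 (D powr (1 / (p - 1)))"
  have "C * \<bar>s\<bar> \<le> a * \<bar>s\<bar> powr p" if s: "\<tau> \<le> \<bar>s\<bar>" for s
  proof -
    have s0: "0 < \<bar>s\<bar>" using s by (auto simp: \<tau>_def)
    have "C / a \<le> D" by (simp add: D_def)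
    also have "D = (D powr (1 / (p - 1))) powr (p - 1)"
      using assms(1) by (simp add: powr_powr D_def)
    also have "\<dots> \<le> \<bar>s\<bar> powr (p - 1)"
      using s assms(1) by (intro powr_mono2) (auto simp: \<tau>_def)
    finally have "C \<le> a * \<bar>s\<bar> powr (p - 1)" using assms(2) by (simp add: field_simps)
    then have "C * \<bar>s\<bar> \<le> a * \<bar>s\<bar> powr (p - 1) * \<bar>s\<bar>" using s0 by (intro mult_right_mono) auto
    also have "\<dots> = a * \<bar>s\<bar> powr p" using powr_add[of "\<bar>s\<bar>" "p - 1" 1] s0 by simp
    finally show ?thesis .
  qed
  moreover have "1 \<le> \<tau>" by (simp add: \<tau>_def)
  ultimately show ?thesis using that by blast
qed

text \<open>Beyond radius \<open>1\<close> the constant \<open>D\<close> is at most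
  \<open>D * \<bar>s\<bar>\<close>, so it is absorbed into a larger linear coefficient.\<close>

lemma powr_growth_affine:
  fixes p a K D :: real
  assumes "1 < p" "0 < a" "0 \<le> D"
  obtains \<tau> where "1 \<le> \<tau>" "\<And>s. \<tau> \<le> \<bar>s\<bar> \<Longrightarrow> K * \<bar>s\<bar> \<le> a * \<bar>s\<bar> powr p - D"
proof -
  obtain \<tau> where \<tau>: "1 \<le> \<tau>" "\<And>s. \<tau> \<le> \<bar>s\<bar> \<Longrightarrow> (K + D) * \<bar>s\<bar> \<le> a * \<bar>s\<bar> powr p"
    using powr_growth[OF assms(1,2)] by blast
  have "K * \<bar>s\<bar> \<le> a * \<bar>s\<bar> powr p - D" if "\<tau> \<le> \<bar>s\<bar>" for s
  proof -
    have "D * 1 \<le> D * \<bar>s\<bar>" using assms(3) that \<tau>(1) by (intro mult_left_mono) auto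
    then show ?thesis using \<tau>(2)[OF that] by (simp add: distrib_right)
  qed
  with \<tau>(1) that show ?thesis by blast
qed

text \<open>The tangent of the minorant on \<open>[- c, c]\<close> is controlled by values of \<open>f\<close> near \<open>0\<close>; if \<open>f\<close>
  grows fast enough outside, this tangent lies below \<open>f\<close> everywhere, and so localisation does not
  change the slope at \<open>0\<close> at all.\<close>

lemma top_tangent_localisation:
  fixes f :: "real \<Rightarrow> real"
  assumes c: "1 \<le> c" and I: "{-c..c} \<subseteq> I"
    and low: "\<And>s. s \<in> {-c..c} \<Longrightarrow> - D \<le> f s"
    and up: "f 0 \<le> D" "f 1 \<le> U" "f (-1) \<le> U"
    and far: "\<And>s. s \<in> I - {-c..c} \<Longrightarrow> (U + 2 * D) * \<bar>s\<bar> \<le> f s"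
  obtains m where "top_tangent I f 0 m (right_deriv (gcm {-c..c} f) 0)"
proof -
  let ?b = "right_deriv (gcm {-c..c} f) 0" and ?m = "gcm {-c..c} f 0"
  have T: "top_tangent {-c..c} f 0 ?m ?b"
  proof (rule gcm_top_tangent)
    show "is_interval {-c..c}" by simp
    show "0 \<in> interior {-c..c}" using c by simp
    show "- D + 0 * (s - 0) \<le> f s" if "s \<in> {-c..c}" for s using low[OF that] by simp
  qed
  have D: "0 \<le> D" using low[of 0] up(1) c by simp
  have supp: "?m + ?b * s \<le> f s" if "s \<in> {-c..c}" for s
    using T that unfolding top_tangent_def by auto
  have "\<forall>s\<in>{-c..c}. - D + 0 * (s - 0) \<le> f s" using low by simp
  then have m: "- D \<le> ?m" using T unfolding top_tangent_def by blast
  have m': "?m \<le> D" using supp[of 0] up(1) c by simp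
  \<comment> \<open>The height lies between \<open>- D\<close> and \<open>D\<close>, and the values
    of \<open>f\<close> at \<open>1\<close> and \<open>-1\<close> bound the slope. For
    \<open>1 \<le> \<bar>s\<bar>\<close> the tangent is then at most
    \<open>D + (U + D) * \<bar>s\<bar>\<close>, whence the coefficient \<open>U + 2 * D\<close> in
    \<open>far\<close>.\<close>
  have b: "\<bar>?b\<bar> \<le> U + D" using supp[of 1] supp[of "- 1"] up(2,3) m c by simp
  have "top_tangent I f 0 ?m ?b"
  proof (rule top_tangent_extend[OF T I])
    fix s assume s: "s \<in> I - {-c..c}"
    then have s1: "1 \<le> \<bar>s\<bar>" using c by auto
    have "?b * s \<le> \<bar>?b\<bar> * \<bar>s\<bar>" by (simp add: abs_mult[symmetric])
    also have "\<dots> \<le> (U + D) * \<bar>s\<bar>" using b by (intro mult_right_mono) auto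
    finally have "?b * s \<le> (U + D) * \<bar>s\<bar>" .
    moreover have "D * 1 \<le> D * \<bar>s\<bar>" using D s1 by (intro mult_left_mono) auto
    moreover have "(U + 2 * D) * \<bar>s\<bar> = (U + D) * \<bar>s\<bar> + D * \<bar>s\<bar>" by (simp add: algebra_simps)
    ultimately have "?m + ?b * s \<le> f s" using far[OF s] m' by linarith
    then show "?m + ?b * (s - 0) \<le> f s" by simp
  qed
  then show ?thesis by (rule that)
qed

text \<open>The infima in (A4) are extended reals. Here \<open>I1\<close> is finite, so
  \<open>I2\<close> being minus infinity would make the difference infinite and is excluded by the
  last hypothesis; a finite \<open>I2\<close> is smaller than \<open>I1\<close> by at most
  one.\<close>

lemma ereal_diff_lower:
  fixes I1 I2 :: ereal
  assumes "ereal (K + 1) \<le> I1" "I1 \<noteq> \<infinity>" "\<not> I1 - I2 > ereal 1"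
  shows "ereal K \<le> I2"
  using assms by (cases I1; cases I2) auto

lemma ereal_diff_upper:
  fixes S1 S2 :: ereal
  assumes "S1 \<le> ereal (- (K + 1))" "S1 \<noteq> -\<infinity>" "\<not> S1 - S2 < ereal (- 1)"
  shows "S2 \<le> ereal (- K)"
  using assms by (cases S1; cases S2) auto

text \<open>Linear growth passes from the window to the whole right half of \<open>I\<close>:
  outside the bad event of (A4) for error \<open>1\<close>, the infimum of \<open>f s / s\<close>
  drops by at most one when the bound \<open>s \<le> c\<close> is lifted, so slope
  \<open>K + 1\<close> becomes slope \<open>K\<close>.\<close>

lemma slope_bound_right:
  fixes f :: "real \<Rightarrow> real"
  assumes I: "{\<tau>..c} \<subseteq> I" and \<tau>: "0 < \<tau>" "\<tau> \<le> c"
    and near: "\<And>s. \<tau> \<le> s \<Longrightarrow> s \<le> c \<Longrightarrow> (K + 1) * s \<le> f s"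
    and diff: "\<not> (INF s\<in>{s\<in>I. \<tau> \<le> s \<and> s \<le> c}. ereal (f s / s)) -
      (INF s\<in>{s\<in>I. \<tau> \<le> s}. ereal (f s / s)) > ereal 1"
    and s: "s \<in> I" "\<tau> \<le> s"
  shows "K * s \<le> f s"
proof -
  have "ereal K \<le> (INF s\<in>{s\<in>I. \<tau> \<le> s}. ereal (f s / s))"
  proof (rule ereal_diff_lower[OF _ _ diff])
    show "ereal (K + 1) \<le> (INF s\<in>{s\<in>I. \<tau> \<le> s \<and> s \<le> c}. ereal (f s / s))"
      using near \<tau> by (intro INF_greatest) (auto simp: pos_le_divide_eq)
    have "(INF s\<in>{s\<in>I. \<tau> \<le> s \<and> s \<le> c}. ereal (f s / s)) \<le> ereal (f \<tau> / \<tau>)"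
      using I \<tau> by (intro INF_lower) auto
    then show "(INF s\<in>{s\<in>I. \<tau> \<le> s \<and> s \<le> c}. ereal (f s / s)) \<noteq> \<infinity>" by auto
  qed
  also have "\<dots> \<le> ereal (f s / s)" using s by (intro INF_lower) auto
  finally show ?thesis using s \<tau> by (simp add: pos_le_divide_eq)
qed

text \<open>Division by negative \<open>s\<close> turns growth of \<open>f\<close> into an upper
  bound on the quotient, so suprema and the bound \<open>- (K + 1)\<close> take over the previous
  roles.\<close>

lemma slope_bound_left:
  fixes f :: "real \<Rightarrow> real"
  assumes I: "{-c..-\<tau>} \<subseteq> I" and \<tau>: "0 < \<tau>" "\<tau> \<le> c"
    and near: "\<And>s. -c \<le> s \<Longrightarrow> s \<le> -\<tau> \<Longrightarrow> (K + 1) * (- s) \<le> f s"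
    and diff: "\<not> (SUP s\<in>{s\<in>I. - c \<le> s \<and> s \<le> - \<tau>}. ereal (f s / s)) -
      (SUP s\<in>{s\<in>I. s \<le> - \<tau>}. ereal (f s / s)) < ereal (- 1)"
    and s: "s \<in> I" "s \<le> - \<tau>"
  shows "K * (- s) \<le> f s"
proof -
  have "ereal (f s / s) \<le> (SUP s\<in>{s\<in>I. s \<le> - \<tau>}. ereal (f s / s))"
    using s by (intro SUP_upper) auto
  also have "\<dots> \<le> ereal (- K)"
  proof (rule ereal_diff_upper[OF _ _ diff])
    have "f s / s \<le> - (K + 1)" if "-c \<le> s" "s \<le> -\<tau>" for s
    proof -
      have "s < 0" using that \<tau> by simp
      then show ?thesis using near[OF that] by (subst neg_divide_le_eq) (auto simp: algebra_simps)
    qed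
    then show "(SUP s\<in>{s\<in>I. - c \<le> s \<and> s \<le> - \<tau>}. ereal (f s / s)) \<le> ereal (- (K + 1))"
      by (intro SUP_least) auto
    have "ereal (f (- \<tau>) / (- \<tau>)) \<le> (SUP s\<in>{s\<in>I. - c \<le> s \<and> s \<le> - \<tau>}. ereal (f s / s))"
      using I \<tau> by (intro SUP_upper) auto
    then show "(SUP s\<in>{s\<in>I. - c \<le> s \<and> s \<le> - \<tau>}. ereal (f s / s)) \<noteq> -\<infinity>" by auto
  qed
  finally show ?thesis using s \<tau> by (simp add: neg_divide_le_eq)
qed

lemma right_cont_on_rescale:
  fixes x :: "real \<Rightarrow> real"
  assumes d: "0 < d" and x: "right_cont_on J x"
  shows "right_cont_on ((\<lambda>t. (t - t0) / d) ` J) (\<lambda>s. a * (x (t0 + s * d) - x0 - b * s * d))"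
  unfolding right_cont_on_def
proof
  fix s assume "s \<in> (\<lambda>t. (t - t0) / d) ` J"
  then have sJ: "t0 + s * d \<in> J" using d by auto
  let ?F = "at s within (\<lambda>t. (t - t0) / d) ` J \<inter> {s<..}"
  have "filterlim (\<lambda>r. t0 + r * d) (at (t0 + s * d) within J \<inter> {t0 + s * d<..}) ?F"
    unfolding filterlim_at
  proof
    show "\<forall>\<^sub>F r in ?F. t0 + r * d \<in> J \<inter> {t0 + s * d<..} \<and> t0 + r * d \<noteq> t0 + s * d"
      using d by (auto simp: eventually_at_filter intro!: always_eventually)
    show "((\<lambda>r. t0 + r * d) \<longlongrightarrow> t0 + s * d) ?F" by (intro tendsto_intros)
  qed
  from filterlim_compose[OF right_cont_onD[OF x sJ] this]
  show "((\<lambda>s. a * (x (t0 + s * d) - x0 - b * s * d)) \<longlongrightarrow> a * (x (t0 + s * d) - x0 - b * s * d)) ?F"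
    by (intro tendsto_intros)
qed

lemma eventually_Icc_subset_local_dom:
  assumes J: "is_interval J" "t0 \<in> interior J" and d: "\<And>n. 0 < d n" "d \<longlonglongrightarrow> 0"
  shows "\<forall>\<^sub>F n in sequentially. {-c..c} \<subseteq> local_dom J t0 (d n)"
proof -
  obtain e where e: "0 < e" "cball t0 e \<subseteq> J" using J(2) by (meson mem_interior_cball)
  have "(\<lambda>n. \<bar>c\<bar> * d n) \<longlonglongrightarrow> \<bar>c\<bar> * 0" by (intro tendsto_intros d)
  then have "\<forall>\<^sub>F n in sequentially. \<bar>c\<bar> * d n < e" using e(1) by (intro order_tendstoD) auto
  then show ?thesis
  proof eventually_elim
    case (elim n)
    show ?case
    proof
      fix s assume s: "s \<in> {-c..c}"
      have "\<bar>s * d n\<bar> \<le> \<bar>c\<bar> * d n"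
        unfolding abs_mult using s d(1)[of n] by (intro mult_mono) auto
      then have "t0 + s * d n \<in> J" using elim e(2) by (auto simp: cball_def dist_real_def)
      moreover have "s = (t0 + s * d n - t0) / d n" using d(1)[of n] by simp
      ultimately show "s \<in> local_dom J t0 (d n)" unfolding local_dom_def by (rule rev_image_eqI)
    qed
  qed
qed

lemma continuous_abs_powr:
  fixes a p :: real
  assumes "0 < p"
  shows "continuous_on S (\<lambda>s. a * \<bar>s\<bar> powr p)"
  using assms by (intro continuous_intros continuous_on_powr') auto

text \<open>The bound concerns the whole line, with a fixed shape \<open>w\<close> and only the
  constant varying; the events increase with \<open>B\<close>, and their constant can be fixed
  before any window.\<close>

definition envelope :: "'b measure \<Rightarrow> ('b \<Rightarrow> real \<Rightarrow> real) \<Rightarrow> (real \<Rightarrow> real) \<Rightarrow> real \<Rightarrow> 'b set" where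
  "envelope N V w B = {\<omega>\<in>space N. \<forall>s. \<bar>V \<omega> s\<bar> \<le> B + w s}"

lemma measurable_Ball_abs_le:
  assumes V: "V \<in> N \<rightarrow>\<^sub>M DR_ball_algebra" and w: "continuous_on S w"
  shows "{\<omega>\<in>space N. \<forall>s\<in>S. \<bar>V \<omega> s\<bar> \<le> w s} \<in> sets N"
proof -
  have VD: "V \<omega> \<in> DR" if "\<omega> \<in> space N" for \<omega> using measurable_space[OF V that] by simp
  have [measurable]: "(\<lambda>\<omega>. V \<omega> s) \<in> borel_measurable N" for s
    by (rule measurable_compose[OF V borel_measurable_DR_eval])
  have m: "(\<lambda>\<omega>. SUP s\<in>S. ereal (\<bar>V \<omega> s\<bar> - w s)) \<in> borel_measurable N"
    by (intro borel_measurable_SUP_right_cont right_cont_on_ereal right_cont_on_diff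
        right_cont_on_abs continuous_on_right_cont_on w right_cont_on_DR VD) auto
  have "{\<omega>\<in>space N. \<forall>s\<in>S. \<bar>V \<omega> s\<bar> \<le> w s} = {\<omega>\<in>space N. (SUP s\<in>S. ereal (\<bar>V \<omega> s\<bar> - w s)) \<le> 0}"
    by (simp add: SUP_le_iff zero_ereal_def)
  then show ?thesis using m by simp
qed

lemma envelope_sets:
  assumes "V \<in> N \<rightarrow>\<^sub>M DR_ball_algebra" and w: "continuous_on UNIV w"
  shows "envelope N V w B \<in> sets N"
  using measurable_Ball_abs_le[OF assms(1), of UNIV "\<lambda>s. B + w s"] w
  by (simp add: envelope_def continuous_on_add)

text \<open>(A5) with error \<open>1/4\<close> puts the noise below
  \<open>A / 4 * \<bar>s\<bar> powr p\<close> outside a compact interval, with probability at least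
  \<open>1 - \<delta>\<close>. On the interval a path in \<open>DR\<close> is bounded, and the
  path-dependent bound goes into \<open>n\<close>. Since \<open>\<delta>\<close> is arbitrary, the
  union over \<open>n\<close> has full measure.\<close>

lemma AE_envelope:
  fixes p A :: real
  assumes prob: "prob_space N" and V: "V \<in> N \<rightarrow>\<^sub>M DR_ball_algebra" and A: "0 < A" and p: "1 < p"
    and tail: "\<And>\<epsilon> \<delta>. 0 < \<epsilon> \<Longrightarrow> 0 < \<delta> \<Longrightarrow> \<exists>\<tau>>0.
        \<P>(\<omega> in N. (SUP s\<in>{s. \<tau> \<le> \<bar>s\<bar>}. ereal \<bar>V \<omega> s / (A * \<bar>s\<bar> powr p)\<bar>) > ereal \<epsilon>) \<le> \<delta>"
  shows "AE \<omega> in N. \<exists>n::nat. \<omega> \<in> envelope N V (\<lambda>s. A / 4 * \<bar>s\<bar> powr p) (real n)"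
proof -
  interpret prob_space N by fact
  let ?w = "\<lambda>s. A / 4 * \<bar>s\<bar> powr p"
  have w: "continuous_on S ?w" for S using p by (intro continuous_abs_powr) simp
  have VD: "V \<omega> \<in> DR" if "\<omega> \<in> space N" for \<omega> using measurable_space[OF V that] by simp
  define U where "U = (\<Union>n::nat. envelope N V ?w (real n))"
  have U: "U \<in> sets N" unfolding U_def using envelope_sets[OF V w] by blast
  have bound: "1 - \<delta> \<le> measure N U" if \<delta>: "0 < \<delta>" for \<delta>
  proof -
    obtain \<tau> where \<tau>: "0 < \<tau>"
      "\<P>(\<omega> in N. (SUP s\<in>{s. \<tau> \<le> \<bar>s\<bar>}. ereal \<bar>V \<omega> s / (A * \<bar>s\<bar> powr p)\<bar>) > ereal (1/4)) \<le> \<delta>"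
      using tail[of "1/4" \<delta>] \<delta> by auto
    define E where "E = {\<omega>\<in>space N. \<forall>s\<in>{s. \<tau> \<le> \<bar>s\<bar>}. \<bar>V \<omega> s\<bar> \<le> ?w s}"
    have E: "E \<in> sets N" unfolding E_def by (rule measurable_Ball_abs_le[OF V w])
    have frac: "\<bar>V \<omega> s / (A * \<bar>s\<bar> powr p)\<bar> \<le> 1/4 \<longleftrightarrow> \<bar>V \<omega> s\<bar> \<le> ?w s" if "\<tau> \<le> \<bar>s\<bar>" for \<omega> s
    proof -
      have "s \<noteq> 0" using that \<tau>(1) by auto
      then have "0 < A * \<bar>s\<bar> powr p" using A by (intro mult_pos_pos) simp_all
      then show ?thesis by (simp add: abs_divide pos_divide_le_eq)
    qed
    have "{\<omega>\<in>space N. (SUP s\<in>{s. \<tau> \<le> \<bar>s\<bar>}. ereal \<bar>V \<omega> s / (A * \<bar>s\<bar> powr p)\<bar>) > ereal (1/4)} = space N - E"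
    proof -
      have "(SUP s\<in>{s. \<tau> \<le> \<bar>s\<bar>}. ereal \<bar>V \<omega> s / (A * \<bar>s\<bar> powr p)\<bar>) \<le> ereal (1/4) \<longleftrightarrow>
          (\<forall>s\<in>{s. \<tau> \<le> \<bar>s\<bar>}. \<bar>V \<omega> s\<bar> \<le> ?w s)" for \<omega>
        unfolding SUP_le_iff by (rule ball_cong[OF refl]) (simp only: ereal_less_eq mem_Collect_eq frac)
      then show ?thesis unfolding E_def not_le[symmetric] by blast
    qed
    then have "1 - \<delta> \<le> measure N E" using \<tau>(2) prob_compl[OF E] by simp
    also have "E \<subseteq> U"
    proof
      fix \<omega> assume \<omega>: "\<omega> \<in> E"
      then have \<omega>N: "\<omega> \<in> space N" by (simp add: E_def)
      obtain B where B: "\<forall>s\<in>{-\<tau>..\<tau>}. \<bar>V \<omega> s\<bar> \<le> B" using DR_bounded_on_interval[OF VD[OF \<omega>N]] by blast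
      obtain n where n: "B \<le> real n" using real_arch_simple by blast
      have "\<bar>V \<omega> s\<bar> \<le> real n + ?w s" for s
      proof (cases "\<tau> \<le> \<bar>s\<bar>")
        case True
        then show ?thesis using \<omega> unfolding E_def by force
      next
        case False
        then have "s \<in> {-\<tau>..\<tau>}" by auto
        then have "\<bar>V \<omega> s\<bar> \<le> B" using B by blast
        moreover have "0 \<le> ?w s" using A by simp
        ultimately show ?thesis using n by linarith
      qed
      then show "\<omega> \<in> U" using \<omega>N unfolding U_def envelope_def by blast
    qed
    then have "measure N E \<le> measure N U" using U by (rule finite_measure_mono)
    finally show ?thesis .
  qed
  have "1 \<le> measure N U"
  proof (rule field_le_epsilon)
    fix e :: real assume "0 < e"
    then show "1 \<le> measure N U + e" using bound[of e] by linarith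
  qed
  then have "measure N U = 1" using prob_le_1[of U] by simp
  then have "AE \<omega> in N. \<omega> \<in> U" using U by (simp add: prob_eq_1)
  then show ?thesis by eventually_elim (auto simp: U_def)
qed

lemma envelope_prob:
  assumes prob: "prob_space N" and V: "V \<in> N \<rightarrow>\<^sub>M DR_ball_algebra" and w: "continuous_on UNIV w"
    and AE: "AE \<omega> in N. \<exists>n::nat. \<omega> \<in> envelope N V w (real n)" and \<delta>: "0 < \<delta>"
  obtains n :: nat where "1 - \<delta> < measure N (envelope N V w (real n))"
proof -
  interpret prob_space N by fact
  have sets: "envelope N V w B \<in> sets N" for B by (rule envelope_sets[OF V w])
  have "incseq (\<lambda>n. envelope N V w (real n))"
    unfolding incseq_def envelope_def by (auto intro: order_trans)
  then have lim: "(\<lambda>n. measure N (envelope N V w (real n))) \<longlonglongrightarrow> measure N (\<Union>n. envelope N V w (real n))"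
    using sets by (intro finite_Lim_measure_incseq) auto
  have "(\<Union>n. envelope N V w (real n)) \<in> sets N" using sets by blast
  moreover have "AE \<omega> in N. \<omega> \<in> (\<Union>n. envelope N V w (real n))" using AE by simp
  ultimately have "measure N (\<Union>n. envelope N V w (real n)) = 1" using prob_eq_1 by blast
  then have "\<forall>\<^sub>F n in sequentially. 1 - \<delta> < measure N (envelope N V w (real n))"
    using lim \<delta> by (intro order_tendstoD) auto
  then show ?thesis using that eventually_happens by fastforce
qed

subsection \<open>Weak convergence of the slope\<close>

theorem theorem2:
  fixes J :: "real set" and t0 p A :: real and d :: "nat \<Rightarrow> real"
    and M :: "nat \<Rightarrow> 'a measure" and N :: "'b measure"
    and xb :: "nat \<Rightarrow> real \<Rightarrow> real"
    and v x :: "nat \<Rightarrow> 'a \<Rightarrow> real \<Rightarrow> real"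
    and V :: "'b \<Rightarrow> real \<Rightarrow> real"
    and Jn :: "nat \<Rightarrow> real set"
    and g :: "nat \<Rightarrow> real \<Rightarrow> real"
    and vt yn :: "nat \<Rightarrow> 'a \<Rightarrow> real \<Rightarrow> real"
    and y :: "'b \<Rightarrow> real \<Rightarrow> real"
  assumes J: "is_interval J" "t0 \<in> interior J"
    and p: "1 < p"
    and d: "\<And>n. 0 < d n" "decseq d" "d \<longlonglongrightarrow> 0"
    and prob: "\<And>n. prob_space (M n)" "prob_space N"
    and v: "\<And>n \<omega>. \<omega> \<in> space (M n) \<Longrightarrow> v n \<omega> \<in> cadlag_on J"
      "\<And>n t. t \<in> J \<Longrightarrow> (\<lambda>\<omega>. v n \<omega> t) \<in> borel_measurable (M n)"
    and x: "\<And>n \<omega> t. x n \<omega> t = xb n t + v n \<omega> t"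
      "\<And>n \<omega>. \<omega> \<in> space (M n) \<Longrightarrow> x n \<omega> \<in> cadlag_on J"
      "\<And>n. AE \<omega> in M n. bdd_below (x n \<omega> ` J)"
    and Jn: "\<And>n. Jn n = local_dom J t0 (d n)"
    and g: "\<And>n. g n = local_drift p (d n) t0 (xb n)"
    and vt: "\<And>n \<omega>. vt n \<omega> = local_noise p (d n) t0 (v n \<omega>)"
    and yn: "\<And>n \<omega>. yn n \<omega> = local_proc p (d n) t0 (xb n) (v n \<omega>)"
    and y: "\<And>\<omega>. y \<omega> = limit_proc A p (V \<omega>)"
    and A1: "\<not> (AE \<omega> in N. \<forall>s. V \<omega> s = 0)"
      "conv_in_distr_DR M (\<lambda>n \<omega>. const_extension (Jn n) (vt n \<omega>)) N V"
    and A2: "\<And>n. convex_on J (xb n)" "0 < A"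
      "\<And>c. 0 < c \<Longrightarrow>
        (\<lambda>n. SUP s\<in>{s\<in>Jn n. \<bar>s\<bar> \<le> c}. ereal \<bar>g n s - A * \<bar>s\<bar> powr p\<bar>) \<longlonglongrightarrow> 0"
    and A3: "\<And>\<delta>. 0 < \<delta> \<Longrightarrow> \<exists>\<tau>>0. \<exists>\<kappa>>0.
        liminf (\<lambda>n. ereal (\<P>(\<omega> in M n.
          0 < (INF s\<in>{s\<in>Jn n. \<tau> \<le> \<bar>s\<bar>}. ereal (yn n \<omega> s - \<kappa> * \<bar>s\<bar>))))) > ereal (1 - \<delta>)"
    and A4: "\<And>\<epsilon> \<delta> \<tau>. 0 < \<epsilon> \<Longrightarrow> 0 < \<delta> \<Longrightarrow> 0 < \<tau> \<Longrightarrow> \<forall>\<^sub>F c in at_top.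
        limsup (\<lambda>n. ereal (\<P>(\<omega> in M n.
          (INF s\<in>{s\<in>Jn n. \<tau> \<le> s \<and> s \<le> c}. ereal (yn n \<omega> s / s)) -
          (INF s\<in>{s\<in>Jn n. \<tau> \<le> s}. ereal (yn n \<omega> s / s)) > ereal \<epsilon>))) < ereal \<delta> \<and>
        limsup (\<lambda>n. ereal (\<P>(\<omega> in M n.
          (SUP s\<in>{s\<in>Jn n. - c \<le> s \<and> s \<le> - \<tau>}. ereal (yn n \<omega> s / s)) -
          (SUP s\<in>{s\<in>Jn n. s \<le> - \<tau>}. ereal (yn n \<omega> s / s)) < ereal (- \<epsilon>)))) < ereal \<delta>"
    and A5: "\<And>\<epsilon> \<delta>. 0 < \<epsilon> \<Longrightarrow> 0 < \<delta> \<Longrightarrow> \<exists>\<tau>>0.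
        \<P>(\<omega> in N. (SUP s\<in>{s. \<tau> \<le> \<bar>s\<bar>}. ereal \<bar>V \<omega> s / (A * \<bar>s\<bar> powr p)\<bar>) > ereal \<epsilon>) \<le> \<delta>"
    and A6: "\<And>c. 0 < c \<Longrightarrow>
        conv_in_distr M (\<lambda>n \<omega>. right_deriv (gcm ({-c..c} \<inter> Jn n) (yn n \<omega>)) 0)
          N (\<lambda>\<omega>. right_deriv (gcm {-c..c} (y \<omega>)) 0)"
  shows "conv_in_distr
        M (\<lambda>n \<omega>. d n powr (- p + 1) * (right_deriv (gcm J (x n \<omega>)) t0 - right_deriv (xb n) t0))
        N (\<lambda>\<omega>. right_deriv (gcm UNIV (y \<omega>)) 0) \<and>
      (\<forall>a. \<P>(\<omega> in N. right_deriv (gcm UNIV (y \<omega>)) 0 = a) = 0 \<longrightarrow>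
        (AE \<omega> in N. \<exists>s. is_arg_min (\<lambda>s. y \<omega> s - a * s) (\<lambda>_. True) s) \<longrightarrow>
        (\<lambda>n. \<P>(\<omega> in M n.
          d n powr (- p + 1) * (right_deriv (gcm J (x n \<omega>)) t0 - right_deriv (xb n) t0) < a))
        \<longlonglongrightarrow> \<P>(\<omega> in completion N. 0 < left_arg_min (\<lambda>s. y \<omega> s - a * s)))"
proof -

  \<comment> \<open>Notation, regularity of the paths and measurability of the slopes\<close>
  let ?w = "\<lambda>s. A / 4 * \<bar>s\<bar> powr p"
  define b where "b n = right_deriv (xb n) t0" for n
  define X where "X n \<omega> = d n powr (- p + 1) * (right_deriv (gcm J (x n \<omega>)) t0 - b n)" for n \<omega>
  define Y where "Y \<omega> = right_deriv (gcm UNIV (y \<omega>)) 0" for \<omega>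
  interpret N: prob_space N by (rule prob(2))
  interpret M: prob_space "M n" for n by (rule prob(1))
  have V: "V \<in> N \<rightarrow>\<^sub>M DR_ball_algebra" using A1(2) unfolding conv_in_distr_DR_def by blast
  have VD: "V \<omega> \<in> DR" if "\<omega> \<in> space N" for \<omega> using measurable_space[OF V that] by simp
  have V_eval[measurable]: "(\<lambda>\<omega>. V \<omega> s) \<in> borel_measurable N" for s
    by (rule measurable_compose[OF V borel_measurable_DR_eval])
  have w: "continuous_on S ?w" for S using p by (intro continuous_abs_powr) simp
  have y_eq: "y \<omega> s = A * \<bar>s\<bar> powr p + V \<omega> s" for \<omega> s by (simp add: y limit_proc_def)
  \<comment> \<open>Drift and noise add up to increments of \<open>x n\<close>, so
    \<open>yn n\<close> is an affinely corrected rescaling of the process itself; in this form its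
    tangents can be transported back to \<open>J\<close>.\<close>
  have yn_eq: "yn n \<omega> s = d n powr (- p) * (x n \<omega> (t0 + s * d n) - x n \<omega> t0 - b n * s * d n)" for n \<omega> s
    by (simp add: yn local_proc_def local_drift_def local_noise_def x(1) b_def algebra_simps)
  have yn_sum: "yn n \<omega> s = g n s + vt n \<omega> s" for n \<omega> s by (simp add: yn g vt local_proc_def)
  have t0J: "t0 \<in> J" using J(2) interior_subset by blast
  have x_meas[measurable]: "(\<lambda>\<omega>. x n \<omega> t) \<in> borel_measurable (M n)" if "t \<in> J" for n t
    using v(2)[OF that] by (simp add: x(1))
  have x_rc: "right_cont_on J (x n \<omega>)" if "\<omega> \<in> space (M n)" for n \<omega>
    using cadlag_on_right_cont_on x(2) that by blast
  have Jn_J: "t0 + s * d n \<in> J" if "s \<in> Jn n" for n s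
    using that d(1)[of n] by (auto simp: Jn local_dom_def)
  have yn_meas: "(\<lambda>\<omega>. yn n \<omega> s) \<in> borel_measurable (M n)" if "s \<in> Jn n" for n s
    using x_meas[OF Jn_J[OF that]] x_meas[OF t0J, of n] unfolding yn_eq by measurable
  have yn_rc: "right_cont_on (Jn n) (yn n \<omega>)" if "\<omega> \<in> space (M n)" for n \<omega>
    unfolding Jn local_dom_def yn_eq[abs_def] by (rule right_cont_on_rescale[OF d(1) x_rc[OF that]])
  have quot_rc: "right_cont_on S (\<lambda>s. ereal (yn n \<omega> s / s))"
    if "\<omega> \<in> space (M n)" "S \<subseteq> Jn n" "0 \<notin> S" for S n \<omega>
    using that(3)
    by (intro right_cont_on_ereal right_cont_on_divide right_cont_on_subset[OF yn_rc[OF that(1)] that(2)]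
        continuous_on_right_cont_on continuous_on_id) auto
  have quot_meas: "(\<lambda>\<omega>. ereal (yn n \<omega> s / s)) \<in> borel_measurable (M n)" if "s \<in> Jn n" for n s
    using yn_meas[OF that] by measurable
  have X_meas: "X n \<in> borel_measurable (M n)" for n
    unfolding X_def[abs_def]
    by (intro borel_measurable_times borel_measurable_diff borel_measurable_const
        borel_measurable_right_deriv_gcm[OF J x_rc x_meas])
  have y_rc: "right_cont_on UNIV (y \<omega>)" if "\<omega> \<in> space N" for \<omega>
  proof -
    have "right_cont_on UNIV (\<lambda>s. V \<omega> s - (- A) * \<bar>s\<bar> powr p)"
      using p by (intro right_cont_on_diff right_cont_on_DR VD that continuous_on_right_cont_on
          continuous_abs_powr) simp
    then show ?thesis unfolding y_eq[abs_def] by (simp add: add.commute)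
  qed
  have Y_meas: "Y \<in> borel_measurable N"
    unfolding Y_def[abs_def]
  proof (rule borel_measurable_right_deriv_gcm)
    show "(\<lambda>\<omega>. y \<omega> s) \<in> borel_measurable N" for s unfolding y_eq by measurable
  qed (simp_all add: y_rc)

  \<comment> \<open>Growth bounds and localisation for the limit process\<close>
  have y_bounds: "3/4 * A * \<bar>s\<bar> powr p - B \<le> y \<omega> s" "y \<omega> s \<le> 5/4 * A * \<bar>s\<bar> powr p + B"
    if "\<omega> \<in> envelope N V ?w B" for \<omega> s B
  proof -
    have "\<bar>V \<omega> s\<bar> \<le> B + ?w s" using that unfolding envelope_def by blast
    then show "3/4 * A * \<bar>s\<bar> powr p - B \<le> y \<omega> s" "y \<omega> s \<le> 5/4 * A * \<bar>s\<bar> powr p + B"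
      unfolding y_eq by linarith+
  qed
  have AE_env: "AE \<omega> in N. \<exists>n::nat. \<omega> \<in> envelope N V ?w (real n)"
    by (rule AE_envelope[OF prob(2) V A2(2) p A5])
  \<comment> \<open>The coefficient in \<open>far\<close> is the \<open>U + 2 * D\<close> of the
    localisation lemma for \<open>D = B\<close> and \<open>U = 5/4 * A + B\<close>, the upper bound
    at \<open>1\<close> and \<open>-1\<close>.\<close>
  have y_tangent: "\<exists>m. top_tangent UNIV (y \<omega>) 0 m (right_deriv (gcm {-c..c} (y \<omega>)) 0)"
    if \<omega>: "\<omega> \<in> envelope N V ?w B" and B: "0 \<le> B" and c: "1 \<le> c"
      and far: "\<And>s. c \<le> \<bar>s\<bar> \<Longrightarrow> (5/4 * A + B + 2 * B) * \<bar>s\<bar> \<le> 3/4 * A * \<bar>s\<bar> powr p - B" for \<omega> B c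
  proof -
    note bd = y_bounds[OF \<omega>]
    have "- B \<le> y \<omega> s" for s
    proof -
      have "0 \<le> 3/4 * A * \<bar>s\<bar> powr p" using A2(2) by simp
      then show ?thesis using bd(1)[of s] by linarith
    qed
    moreover have "y \<omega> 0 \<le> B" "y \<omega> 1 \<le> 5/4 * A + B" "y \<omega> (-1) \<le> 5/4 * A + B"
      using bd(2)[of 0] bd(2)[of 1] bd(2)[of "-1"] p by simp_all
    moreover have "(5/4 * A + B + 2 * B) * \<bar>s\<bar> \<le> y \<omega> s" if "s \<in> UNIV - {-c..c}" for s
    proof -
      have "c \<le> \<bar>s\<bar>" using that by auto
      then show ?thesis using far[of s] bd(1)[of s] by linarith
    qed
    ultimately show ?thesis
      using top_tangent_localisation[OF c subset_UNIV, of B "y \<omega>" "5/4 * A + B"] by blast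
  qed

  \<comment> \<open>Convergence in distribution by localisation\<close>
  have conv: "conv_in_distr M X N Y"
  proof (rule conv_in_distr_approx[OF prob X_meas Y_meas])
    fix e :: real assume e: "0 < e"
    \<comment> \<open>The exceptional set consists of paths leaving the noise envelope, costing
      \<open>2 * \<delta>\<close>, and of the two events of (A4), costing \<open>\<delta>\<close>
      each.\<close>
    define \<delta> where "\<delta> = e / 4"
    have \<delta>: "0 < \<delta>" using e by (simp add: \<delta>_def)
    obtain B :: nat where B: "1 - \<delta> < measure N (envelope N V ?w (real B))"
      using envelope_prob[OF prob(2) V w AE_env \<delta>] by blast
    \<comment> \<open>One unit above \<open>B\<close> comes from the ramp of the test function, the
      other from the error of the drift \<open>g n\<close> on the window.\<close>
    define D where "D = real B + 2"
    define K where "K = 5/4 * A + D + 2 * D"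
    have D: "0 \<le> D" "real B \<le> D" by (simp_all add: D_def)
    have "0 < 3/4 * A" using A2(2) by simp
    \<comment> \<open>Localisation needs slope \<open>K\<close>; the surplus of one is spent on (A4)
      with error \<open>1\<close>. Since \<open>\<tau>\<close> does not depend on the window, it may
      be inserted into (A4) before \<open>c\<close> is chosen.\<close>
    from powr_growth_affine[OF p this D(1)] obtain \<tau> where \<tau>: "1 \<le> \<tau>"
      "\<And>s. \<tau> \<le> \<bar>s\<bar> \<Longrightarrow> (K + 1) * \<bar>s\<bar> \<le> 3/4 * A * \<bar>s\<bar> powr p - D" by blast
    have \<tau>0: "0 < \<tau>" using \<tau>(1) by simp
    have grow: "K * \<bar>s\<bar> \<le> 3/4 * A * \<bar>s\<bar> powr p - D" if "\<tau> \<le> \<bar>s\<bar>" for s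
      using \<tau>(2)[OF that] by (simp add: distrib_right)
    define Lo where "Lo n c \<omega> = (INF s\<in>{s\<in>Jn n. \<tau> \<le> s \<and> s \<le> c}. ereal (yn n \<omega> s / s))" for n c \<omega>
    define Lo' where "Lo' n \<omega> = (INF s\<in>{s\<in>Jn n. \<tau> \<le> s}. ereal (yn n \<omega> s / s))" for n \<omega>
    define Hi where "Hi n c \<omega> = (SUP s\<in>{s\<in>Jn n. - c \<le> s \<and> s \<le> - \<tau>}. ereal (yn n \<omega> s / s))" for n c \<omega>
    define Hi' where "Hi' n \<omega> = (SUP s\<in>{s\<in>Jn n. s \<le> - \<tau>}. ereal (yn n \<omega> s / s))" for n \<omega>
    have LH_meas: "Lo n c \<in> borel_measurable (M n)" "Lo' n \<in> borel_measurable (M n)"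
        "Hi n c \<in> borel_measurable (M n)" "Hi' n \<in> borel_measurable (M n)" for n c
      unfolding Lo_def[abs_def] Lo'_def[abs_def] Hi_def[abs_def] Hi'_def[abs_def]
      using \<tau>0 by (auto intro!: borel_measurable_INF_right_cont borel_measurable_SUP_right_cont
          quot_rc quot_meas)
    define Bad1 where "Bad1 n c = {\<omega>\<in>space (M n). Lo n c \<omega> - Lo' n \<omega> > ereal 1}" for n c
    define Bad2 where "Bad2 n c = {\<omega>\<in>space (M n). Hi n c \<omega> - Hi' n \<omega> < ereal (- 1)}" for n c
    have Bad_sets: "Bad1 n c \<in> sets (M n)" "Bad2 n c \<in> sets (M n)" for n c
    proof -
      note LH_meas[measurable]
      show "Bad1 n c \<in> sets (M n)" "Bad2 n c \<in> sets (M n)"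
        unfolding Bad1_def Bad2_def by measurable
    qed
    have "\<forall>\<^sub>F c in at_top. limsup (\<lambda>n. ereal (measure (M n) (Bad1 n c))) < ereal \<delta> \<and>
        limsup (\<lambda>n. ereal (measure (M n) (Bad2 n c))) < ereal \<delta>"
      unfolding Bad1_def Bad2_def Lo_def Lo'_def Hi_def Hi'_def
      by (rule A4[OF zero_less_one \<delta> \<tau>0])
    then obtain c0 where c0: "\<And>c. c0 \<le> c \<Longrightarrow> limsup (\<lambda>n. ereal (measure (M n) (Bad1 n c))) < ereal \<delta> \<and>
        limsup (\<lambda>n. ereal (measure (M n) (Bad2 n c))) < ereal \<delta>"
      unfolding eventually_at_top_linorder by blast
    \<comment> \<open>The half-width \<open>c\<close> is made a positive integer because the excess
      is controlled on such windows.\<close>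
    obtain k where k: "max c0 \<tau> \<le> real k" using real_arch_simple by blast
    define c where "c = real (Suc k)"
    have c: "c0 \<le> c" "\<tau> \<le> c" "1 \<le> c" "0 < c" using k by (auto simp: c_def)
    let ?Z = "\<lambda>n \<omega>. right_deriv (gcm ({-c..c} \<inter> Jn n) (yn n \<omega>)) 0"
    let ?W = "\<lambda>\<omega>. right_deriv (gcm {-c..c} (y \<omega>)) 0"
    define Ext where "Ext n \<omega> = const_extension (Jn n) (vt n \<omega>)" for n \<omega>
    define G where "G n = {\<omega>\<in>space (M n). \<forall>s\<in>{-c..c}. \<bar>Ext n \<omega> s\<bar> \<le> real B + 1 + ?w s}" for n
    have G: "G n \<in> sets (M n)" "\<forall>\<^sub>F n in sequentially. 1 - 2 * \<delta> < measure (M n) (G n)" for n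
      unfolding G_def c_def Ext_def
      using conv_in_distr_DR_excess[OF A1(2) prob w envelope_sets[OF V w] less_imp_le[OF B] _ \<delta>, of k]
      by (auto simp: envelope_def)
    have ev1: "\<forall>\<^sub>F n in sequentially. measure (M n) (Bad1 n c) < \<delta>"
      using Limsup_lessD[OF conjunct1[OF c0[OF c(1)]]] by simp
    have ev2: "\<forall>\<^sub>F n in sequentially. measure (M n) (Bad2 n c) < \<delta>"
      using Limsup_lessD[OF conjunct2[OF c0[OF c(1)]]] by simp
    have ev3: "\<forall>\<^sub>F n in sequentially. {-c..c} \<subseteq> Jn n"
      unfolding Jn by (rule eventually_Icc_subset_local_dom[OF J d(1,3)])
    have ev4: "\<forall>\<^sub>F n in sequentially. (SUP s\<in>{s\<in>Jn n. \<bar>s\<bar> \<le> c}. ereal \<bar>g n s - A * \<bar>s\<bar> powr p\<bar>) < 1"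
      using A2(3)[OF c(4)] by (rule order_tendstoD) simp
    have "\<forall>\<^sub>F n in sequentially. \<exists>H\<in>sets (M n). 1 - e < measure (M n) H \<and> (\<forall>\<omega>\<in>H. X n \<omega> = ?Z n \<omega>)"
      using ev1 ev2 ev3 ev4 G(2)
    proof eventually_elim
      case (elim n)
      let ?H = "G n - (Bad1 n c \<union> Bad2 n c)"
      have "measure (M n) (G n) \<le> measure (M n) (?H \<union> (Bad1 n c \<union> Bad2 n c))"
        using G(1) Bad_sets by (intro M.finite_measure_mono) auto
      also have "\<dots> \<le> measure (M n) ?H + measure (M n) (Bad1 n c \<union> Bad2 n c)"
        using G(1) Bad_sets by (intro measure_Un_le) auto
      also have "\<dots> \<le> measure (M n) ?H + (measure (M n) (Bad1 n c) + measure (M n) (Bad2 n c))"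
        using Bad_sets by (intro add_left_mono measure_Un_le)
      finally have "1 - e < measure (M n) ?H" using elim(1,2,5) by (simp add: \<delta>_def)
      moreover have "?H \<in> sets (M n)" using G(1) Bad_sets by blast
      moreover have "X n \<omega> = ?Z n \<omega>" if "\<omega> \<in> ?H" for \<omega>
      proof -
        have \<omega>: "\<omega> \<in> space (M n)" "\<forall>s\<in>{-c..c}. \<bar>Ext n \<omega> s\<bar> \<le> real B + 1 + ?w s"
          "\<not> Lo n c \<omega> - Lo' n \<omega> > ereal 1" "\<not> Hi n c \<omega> - Hi' n \<omega> < ereal (- 1)"
          using that unfolding G_def Bad1_def Bad2_def by auto
        have near: "3/4 * A * \<bar>s\<bar> powr p - D \<le> yn n \<omega> s" "yn n \<omega> s \<le> 5/4 * A * \<bar>s\<bar> powr p + D"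
          if s: "s \<in> {-c..c}" for s
        proof -
          have sJ: "s \<in> Jn n" using elim(3) s by blast
          have "s \<in> {s\<in>Jn n. \<bar>s\<bar> \<le> c}" using s sJ by auto
          then have "ereal \<bar>g n s - A * \<bar>s\<bar> powr p\<bar> < 1"
            by (rule le_less_trans[OF SUP_upper elim(4)])
          then have 1: "\<bar>g n s - A * \<bar>s\<bar> powr p\<bar> < 1" by simp
          \<comment> \<open>(A1) concerns the extended noise; the window lies inside
            \<open>Jn n\<close>, where the extension is the noise itself.\<close>
          have "Ext n \<omega> s = vt n \<omega> s" using sJ by (simp add: Ext_def const_extension_def)
          then have 2: "\<bar>vt n \<omega> s\<bar> \<le> real B + 1 + ?w s" using \<omega>(2) s by metis
          show "3/4 * A * \<bar>s\<bar> powr p - D \<le> yn n \<omega> s" "yn n \<omega> s \<le> 5/4 * A * \<bar>s\<bar> powr p + D"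
            using 1 2 unfolding yn_sum D_def by linarith+
        qed
        have far: "K * \<bar>s\<bar> \<le> yn n \<omega> s" if s: "s \<in> Jn n" "\<tau> \<le> \<bar>s\<bar>" for s
        proof (cases "0 \<le> s")
          case True
          have "K * s \<le> yn n \<omega> s"
          proof (rule slope_bound_right)
            show "{\<tau>..c} \<subseteq> Jn n" using elim(3) \<tau>0 c(4) by auto
            show "\<not> (INF s\<in>{s\<in>Jn n. \<tau> \<le> s \<and> s \<le> c}. ereal (yn n \<omega> s / s)) -
                (INF s\<in>{s\<in>Jn n. \<tau> \<le> s}. ereal (yn n \<omega> s / s)) > ereal 1"
              using \<omega>(3) unfolding Lo_def Lo'_def .
            show "(K + 1) * r \<le> yn n \<omega> r" if "\<tau> \<le> r" "r \<le> c" for r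
              using \<tau>(2)[of r] near(1)[of r] that \<tau>0 by simp
          qed (use s True \<tau>0 c in auto)
          then show ?thesis using True by simp
        next
          case False
          have "K * (- s) \<le> yn n \<omega> s"
          proof (rule slope_bound_left)
            show "{-c..-\<tau>} \<subseteq> Jn n" using elim(3) \<tau>0 c(4) by auto
            show "\<not> (SUP s\<in>{s\<in>Jn n. - c \<le> s \<and> s \<le> - \<tau>}. ereal (yn n \<omega> s / s)) -
                (SUP s\<in>{s\<in>Jn n. s \<le> - \<tau>}. ereal (yn n \<omega> s / s)) < ereal (- 1)"
              using \<omega>(4) unfolding Hi_def Hi'_def .
            show "(K + 1) * (- r) \<le> yn n \<omega> r" if "- c \<le> r" "r \<le> - \<tau>" for r
              using \<tau>(2)[of r] near(1)[of r] that \<tau>0 by simp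
          qed (use s False \<tau>0 c in auto)
          then show ?thesis using False by simp
        qed
        obtain m where m: "top_tangent (Jn n) (yn n \<omega>) 0 m (right_deriv (gcm {-c..c} (yn n \<omega>)) 0)"
        proof (rule top_tangent_localisation[OF c(3) elim(3)])
          show "- D \<le> yn n \<omega> s" if "s \<in> {-c..c}" for s
          proof -
            have "0 \<le> 3/4 * A * \<bar>s\<bar> powr p" using A2(2) by simp
            then show ?thesis using near(1)[OF that] by linarith
          qed
          show "yn n \<omega> 0 \<le> D" "yn n \<omega> 1 \<le> 5/4 * A + D" "yn n \<omega> (-1) \<le> 5/4 * A + D"
            using near(2)[of 0] near(2)[of 1] near(2)[of "-1"] c(3,4) p by simp_all
          show "(5/4 * A + D + 2 * D) * \<bar>s\<bar> \<le> yn n \<omega> s" if "s \<in> Jn n - {-c..c}" for s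
          proof -
            have "\<tau> \<le> \<bar>s\<bar>" using that c(2) by auto
            then show ?thesis using far[of s] that unfolding K_def by blast
          qed
        qed blast
        have "{-c..c} \<inter> Jn n = {-c..c}" using elim(3) by blast
        then have Z: "right_deriv (gcm {-c..c} (yn n \<omega>)) 0 = ?Z n \<omega>" by simp
        have dp: "0 < d n powr (- p)" using d(1)[of n] by simp
        have "top_tangent ((\<lambda>t. (t - t0) / d n) ` J)
            (\<lambda>s. d n powr (- p) * (x n \<omega> (t0 + s * d n) - x n \<omega> t0 - b n * s * d n)) 0 m (?Z n \<omega>)"
          using m unfolding Z unfolding Jn local_dom_def yn_eq[abs_def] .
        \<comment> \<open>The tangent of \<open>yn n\<close> is transported back to
          \<open>x n\<close> on \<open>J\<close>, its slope being divided by
          \<open>d n powr (- p) * d n\<close>, which is the normalising factor in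
          \<open>X\<close>.\<close>
        from top_tangent_imp_gcm(2)[OF J top_tangent_rescale[OF dp d(1) this]]
        have "right_deriv (gcm J (x n \<omega>)) t0 = b n + ?Z n \<omega> / (d n powr (- p) * d n)" .
        moreover have "d n powr (- p) * d n = d n powr (- p + 1)"
          using d(1)[of n] powr_add[of "d n" "- p" 1] by simp
        ultimately show ?thesis using d(1)[of n] by (simp add: X_def)
      qed
      ultimately show ?case by blast
    qed
    \<comment> \<open>As \<open>B \<le> D\<close>, growth sufficient for the constant
      \<open>D\<close> is sufficient for \<open>B\<close>, so the window chosen for
      \<open>yn n\<close> also serves the limit process.\<close>
    moreover have "Y \<omega> = ?W \<omega>" if "\<omega> \<in> envelope N V ?w (real B)" for \<omega>
    proof -
      have "\<exists>m. top_tangent UNIV (y \<omega>) 0 m (?W \<omega>)"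
      proof (rule y_tangent[OF that])
        fix s assume "c \<le> \<bar>s\<bar>"
        then have "K * \<bar>s\<bar> \<le> 3/4 * A * \<bar>s\<bar> powr p - D" using grow c(2) by simp
        moreover have "(5/4 * A + real B + 2 * real B) * \<bar>s\<bar> \<le> K * \<bar>s\<bar>"
          using D(2) by (intro mult_right_mono) (auto simp: K_def)
        ultimately show "(5/4 * A + real B + 2 * real B) * \<bar>s\<bar> \<le> 3/4 * A * \<bar>s\<bar> powr p - real B"
          using D(2) by linarith
      qed (use c in auto)
      then show ?thesis unfolding Y_def using top_tangent_imp_gcm(2)[of UNIV] by auto
    qed
    moreover have "1 - e < measure N (envelope N V ?w (real B))" using B e by (simp add: \<delta>_def)
    ultimately show "\<exists>Z W. conv_in_distr M Z N W \<and>
      (\<forall>\<^sub>F n in sequentially. \<exists>G\<in>sets (M n). 1 - e < measure (M n) G \<and> (\<forall>\<omega>\<in>G. X n \<omega> = Z n \<omega>)) \<and>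
      (\<exists>E\<in>sets N. 1 - e < measure N E \<and> (\<forall>\<omega>\<in>E. Y \<omega> = W \<omega>))"
      using A6[OF c(4)] envelope_sets[OF V w] by blast
  qed

  \<comment> \<open>The distribution function and the sign of the minimiser\<close>
  have "(\<lambda>n. \<P>(\<omega> in M n. X n \<omega> < a)) \<longlonglongrightarrow>
      \<P>(\<omega> in completion N. 0 < left_arg_min (\<lambda>s. y \<omega> s - a * s))"
    if a: "\<P>(\<omega> in N. Y \<omega> = a) = 0"
      and ex: "AE \<omega> in N. \<exists>s. is_arg_min (\<lambda>s. y \<omega> s - a * s) (\<lambda>_. True) s" for a
  proof -
    note X_meas[measurable] Y_meas[measurable]
    have "(\<lambda>n. measure (distr (M n) borel (X n)) {..<a}) \<longlonglongrightarrow> measure (distr N borel Y) {..<a}"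
    proof (rule weak_conv_imp_continuity_set_conv)
      show "weak_conv_m (\<lambda>n. distr (M n) borel (X n)) (distr N borel Y)"
        using conv unfolding conv_in_distr_def by blast
      have "emeasure (distr N borel Y) {a} = emeasure N {\<omega>\<in>space N. Y \<omega> = a}"
        by (subst emeasure_distr) (auto intro!: arg_cong2[where f=emeasure])
      moreover have "frontier {..<a} = {a}" by (auto simp: frontier_def interior_open)
      ultimately show "emeasure (distr N borel Y) (frontier {..<a}) = 0"
        using a by (simp add: N.emeasure_eq_measure)
    qed (auto intro!: M.real_distribution_distr N.real_distribution_distr)
    moreover have "measure (distr (M n) borel (X n)) {..<a} = \<P>(\<omega> in M n. X n \<omega> < a)" for n
      by (subst measure_distr) (auto intro!: arg_cong2[where f=measure])
    moreover have "measure (distr N borel Y) {..<a} = \<P>(\<omega> in N. Y \<omega> < a)"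
      by (subst measure_distr) (auto intro!: arg_cong2[where f=measure])
    moreover have "\<P>(\<omega> in N. Y \<omega> < a) = \<P>(\<omega> in completion N. 0 < left_arg_min (\<lambda>s. y \<omega> s - a * s))"
    proof -
      let ?S = "{\<omega>\<in>space N. 0 < left_arg_min (\<lambda>s. y \<omega> s - a * s)}"
      let ?L = "{\<omega>\<in>space N. Y \<omega> < a}"
      have L: "?L \<in> sets N" by measurable
      have ne: "AE \<omega> in N. Y \<omega> \<noteq> a"
        using a by (intro AE_I'[of "{\<omega>\<in>space N. Y \<omega> = a}"])
          (auto simp: null_sets_def N.emeasure_eq_measure)
      have "AE \<omega> in N. \<omega> \<in> ?L \<longleftrightarrow> \<omega> \<in> ?S"
        using AE_env ex ne
      proof eventually_elim
        case (elim \<omega>)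
        then obtain B :: nat where B: "\<omega> \<in> envelope N V ?w (real B)" by blast
        then have \<omega>: "\<omega> \<in> space N" by (simp add: envelope_def)
        have A34: "0 < 3/4 * A" using A2(2) by simp
        \<comment> \<open>Here the radius may depend on the path. The additional
          \<open>\<bar>a\<bar> + 1\<close> makes \<open>y \<omega> s - a * s\<close> exceed its
          value at \<open>0\<close> as soon as \<open>c \<le> \<bar>s\<bar>\<close>, so that no
          minimiser lies to the left of \<open>- c\<close>.\<close>
        obtain c where c: "1 \<le> c" "\<And>s. c \<le> \<bar>s\<bar> \<Longrightarrow>
            (5/4 * A + real B + 2 * real B + \<bar>a\<bar> + 1) * \<bar>s\<bar> \<le> 3/4 * A * \<bar>s\<bar> powr p - real B"
          using powr_growth_affine[OF p A34, of "real B"] by auto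
        have "\<exists>m. top_tangent UNIV (y \<omega>) 0 m (right_deriv (gcm {-c..c} (y \<omega>)) 0)"
        proof (rule y_tangent[OF B _ c(1)])
          fix s assume s: "c \<le> \<bar>s\<bar>"
          have "(5/4 * A + real B + 2 * real B) * \<bar>s\<bar> \<le> (5/4 * A + real B + 2 * real B + \<bar>a\<bar> + 1) * \<bar>s\<bar>"
            by (intro mult_right_mono) auto
          then show "(5/4 * A + real B + 2 * real B) * \<bar>s\<bar> \<le> 3/4 * A * \<bar>s\<bar> powr p - real B"
            using c(2)[OF s] by linarith
        qed simp
        then obtain m where T: "top_tangent UNIV (y \<omega>) 0 m (Y \<omega>)"
          unfolding Y_def using top_tangent_imp_gcm(2)[of UNIV] by auto
        have "0 < left_arg_min (\<lambda>s. y \<omega> s - a * s) \<longleftrightarrow> Y \<omega> < a"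
        proof (rule arg_min_pos_iff[OF T elim(3) _ elim(2)])
          show "(y \<omega> \<longlongrightarrow> y \<omega> 0) (at_right 0)"
            using right_cont_onD[OF y_rc[OF \<omega>], of 0] by simp
          have "- c \<le> s" if s: "is_arg_min (\<lambda>s. y \<omega> s - a * s) (\<lambda>_. True) s" for s
          proof (rule ccontr)
            assume "\<not> - c \<le> s"
            then have cs: "c \<le> \<bar>s\<bar>" using c(1) by auto
            have "y \<omega> s - a * s \<le> y \<omega> 0" using s by (auto simp: is_arg_min_linorder dest: spec[of _ 0])
            also have "\<dots> \<le> real B" using y_bounds(2)[OF B, of 0] p by simp
            finally have 1: "y \<omega> s - a * s \<le> real B" .
            have 2: "a * s \<le> \<bar>a\<bar> * \<bar>s\<bar>" by (simp add: abs_mult[symmetric])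
            have 3: "(5/4 * A + real B + 2 * real B + \<bar>a\<bar> + 1) * \<bar>s\<bar> =
                (5/4 * A + 2 * real B + 1) * \<bar>s\<bar> + real B * \<bar>s\<bar> + \<bar>a\<bar> * \<bar>s\<bar>"
              by (simp add: algebra_simps)
            have 4: "real B * 1 \<le> real B * \<bar>s\<bar>" using cs c(1) by (intro mult_left_mono) auto
            have 5: "0 < (5/4 * A + 2 * real B + 1) * \<bar>s\<bar>"
              using A2(2) cs c(1) by (intro mult_pos_pos add_nonneg_pos) auto
            show False using 1 2 3 4 5 c(2)[OF cs] y_bounds(1)[OF B, of s] by linarith
          qed
          then show "bdd_below {s. is_arg_min (\<lambda>s. y \<omega> s - a * s) (\<lambda>_. True) s}"
            by (intro bdd_belowI[of _ "- c"]) simp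
        qed
        then show ?case by blast
      qed
      then have ae: "AE \<omega> in completion N. \<omega> \<in> ?L \<longleftrightarrow> \<omega> \<in> ?S" by (rule AE_completion)
      have LC: "?L \<in> sets (completion N)" using L by simp
      have S: "?S \<in> sets (completion N)" by (rule completion.in_sets_AE[OF ae LC]) auto
      have "measure N ?L = measure (completion N) ?L" using L by simp
      also have "\<dots> = measure (completion N) ?S"
        unfolding measure_def using emeasure_eq_AE[OF ae LC S] by simp
      finally show ?thesis by simp
    qed
    ultimately show ?thesis by simp
  qed
  with conv show ?thesis unfolding X_def[abs_def] Y_def[abs_def] b_def by blast
qed

end
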